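(* Let $N\ge 1000$ and $h>0$ be real numbers, and let $(u_p)_{p\le N}$ be complex numbers indexed by the primes $p\le N$. Then $$\int_0^1\Bigl|\sum_{p\le N}u_p e(p\alpha)\Bigr|^{2+h}d\alpha\le 7000\,\frac{\bigl(1+\tfrac{3}{2\log N}\bigr)^h+1/h}{N}\Bigl(\frac{2N}{\log N}\sum_{p\le N}|u_p|^2\Bigr)^{1+h/2}.$$
   Context: The variable $p$ always denotes a prime number, and sums over $p\le N$ run over primes. We write $e(\alpha)=\exp(2i\pi\alpha)$. *)

theory Defs
  imports "HOL-Analysis.Analysis" "HOL-Computational_Algebra.Primes"
begin

definition e_circ :: "real \<Rightarrow> complex" where
  "e_circ \<alpha> = exp (2 * \<i> * complex_of_real pi * complex_of_real \<alpha>)"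

definition primes_upto :: "real \<Rightarrow> nat set" where
  "primes_upto N = {p. prime p \<and> real p \<le> N}"

end

theory Submission
  imports Defs "HOL-Analysis.Analysis" "HOL-Computational_Algebra.Squarefree"
begin

text \<open>
  Put \<open>S(\<alpha>) = \<Sum>p\<le>N. u p e(p\<alpha>)\<close>, \<open>D = (2N / ln N) \<Sum>p\<le>N. |u p|\<^sup>2\<close> and
  \<open>f = |S| / sqrt D\<close>; the claim becomes \<open>N \<integral> f\<^bsup>2+h\<^esup> \<le> 7000 ((1 + 3/(2 ln N))\<^bsup>h\<^esup> + 1/h)\<close>.
  Parseval gives \<open>N \<integral> f\<^sup>2 = ln N / 2\<close>, and Cauchy--Schwarz together with Chebyshev's bound for the number of
  primes gives \<open>f \<le> 1 + 3/(2 ln N)\<close>.  Hence \<open>f\<^bsup>2+h\<^esup> \<le> (sup f)\<^bsup>h\<^esup> f\<^sup>2\<close> already proves the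
  claim when \<open>ln N \<le> 14000\<close>.

  For larger \<open>N\<close> one has \<open>f \<le> 1\<close>, and the factor \<open>ln N\<close> must be removed.  This is done by the
  restriction estimate \<open>restriction_estimate\<close>: for a measurable set \<open>E\<close> of measure \<open>t / N\<close>, as long
  as \<open>t\<close> is at most \<open>sqrt N\<close>, the integral \<open>N \<integral>\<^sub>E f\<^sup>2\<close> is \<open>O(ln (t + 2))\<close>; for larger \<open>t\<close> this
  is trivial.  Apply it to the level set \<open>E k = {f > 2\<^bsup>-k\<^esup>}\<close>.  On the one hand \<open>N \<integral>\<^bsub>E k\<^esub> f\<^sup>2\<close> is at
  least \<open>4\<^bsup>-k\<^esup> t\<close>, on the other hand it is \<open>O(ln (t + 2))\<close>; so \<open>ln t\<close> and therefore
  \<open>N \<integral>\<^bsub>E k\<^esub> f\<^sup>2\<close> are \<open>O(k + 1)\<close>.  With \<open>r = 2\<^bsup>-h\<^esup>\<close>, summation over the levels with weights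
  \<open>r\<^bsup>j\<^esup> - r\<^bsup>j+1\<^esup>\<close> yields \<open>O(1 / (1 - r)) = O(1 + 1/h)\<close>.

  The restriction estimate is proved in dual form: with \<open>g = 1\<^sub>E cnj S\<close> and
  \<open>\<gamma> n = \<integral> e(n\<alpha>) g(\<alpha>)\<close>, one bounds \<open>\<Sum>p. |\<gamma> p|\<^sup>2\<close> over primes \<open>p > z = N\<^bsup>1/4\<^esup>\<close> by a sum over all integers, weighted by
  a Fejer kernel and by the sieve majorant \<open>|\<nu> n|\<^sup>2 / G\<^sup>2\<close>, where \<open>\<nu>\<close> is the sum over squarefree
  \<open>q \<le> z\<close> of the weighted Ramanujan sums \<open>\<mu>(q) c\<^sub>q(n) / \<phi>(q)\<close> and \<open>G\<close> is the sum of the \<open>1 / \<phi>(q)\<close>.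
  The decisive choice is to admit only moduli \<open>q\<close> all of whose prime factors exceed some \<open>Z\<close> of the
  order of \<open>t\<close>.  Then \<open>|\<nu>|\<^sup>2\<close> has mean value \<open>G\<close>, and at every nonzero frequency its Fourier
  coefficient is at most \<open>3G / Z\<close>.  The mean value contributes a multiple of
  \<open>\<integral> |g|\<^sup>2\<close> by Bessel's inequality.  The remaining frequencies are spaced by \<open>z\<^bsup>-4\<^esup> = 1/N\<close>, so they
  contribute \<open>O((N/Z) (\<integral> |g|)\<^sup>2)\<close>, which the choice of \<open>Z\<close> makes as small as the first term.
  The price for omitting the primes up to \<open>Z\<close> is that \<open>G\<close> is bounded below only by a multiple of \<open>ln N / ln (4Z)\<close>
  (\<open>presieved_sum_ge\<close>), and this quotient is the source of the factor \<open>ln (t + 2)\<close>.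
\<close>

section \<open>Chebyshev and Mertens bounds\<close>

lemma finite_primes_le [simp]: "finite {p::nat. prime p \<and> p \<le> n}"
  by (rule finite_subset[of _ "{..n}"]) auto

lemma middle_binomial_le: "(2*m+1) choose m \<le> 4^m"
proof -
  have "2 * ((2*m+1) choose m) = ((2*m+1) choose m) + ((2*m+1) choose (m+1))"
    using binomial_symmetric[of m "2*m+1"] by simp
  also have "\<dots> = (\<Sum>k\<in>{m,m+1}. (2*m+1) choose k)" by simp
  also have "\<dots> \<le> (\<Sum>k\<le>2*m+1. (2*m+1) choose k)"
    by (rule sum_mono2) auto
  also have "\<dots> = 2 * 4^m" by (subst choose_row_sum) (simp add: power_mult)
  finally show ?thesis by simp
qed

lemma prod_primes_dvd:
  fixes A :: "nat set"
  assumes "finite A" "\<And>p. p \<in> A \<Longrightarrow> prime p" "\<And>p. p \<in> A \<Longrightarrow> p dvd n"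
  shows "\<Prod>A dvd n"
  using assms
proof (induction A rule: finite_induct)
  case (insert p A)
  have "coprime p (\<Prod>A)"
    using insert by (intro prod_coprime_right) (auto intro: primes_coprime)
  with insert show ?case by (auto intro: divides_mult)
qed simp

text \<open>For \<open>n = 2m + 1\<close> the primes in \<open>(m + 1, n]\<close> all divide the binomial coefficient
  \<open>n choose m \<le> 4\<^bsup>m\<^esup>\<close>; an even \<open>n > 2\<close> adds no prime.\<close>
lemma primorial_le: "(\<Prod>{p::nat. prime p \<and> p \<le> n}) \<le> 4 ^ n"
proof (induction n rule: less_induct)
  case (less n)
  show ?case
  proof (cases "n \<le> 2")
    case True
    then consider "n = 0" | "n = 1" | "n = 2" by linarith
    then show ?thesis
    proof cases
      case 1
      have eq: "{p::nat. prime p \<and> p \<le> 0} = {}" by (auto simp: not_prime_0)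
      show ?thesis unfolding 1 eq by simp
    next
      case 2
      have eq: "{p::nat. prime p \<and> p \<le> 1} = {}" by (auto dest: prime_gt_1_nat)
      show ?thesis unfolding 2 eq by simp
    next
      case 3
      have eq: "{p::nat. prime p \<and> p \<le> 2} = {2}"
        using prime_ge_2_nat by (auto intro!: antisym)
      show ?thesis unfolding 3 eq by simp
    qed
  next
    case False
    show ?thesis
    proof (cases "even n")
      case True
      then have "\<not> prime n" using False prime_odd_nat by auto
      then have "{p. prime p \<and> p \<le> n} = {p. prime p \<and> p \<le> n - 1}"
        using False by (auto simp: le_eq_less_or_eq)
      then have "\<Prod>{p. prime p \<and> p \<le> n} \<le> 4 ^ (n-1)" using less[of "n-1"] False by simp
      also have "\<dots> \<le> 4 ^ n" by (rule power_increasing) auto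
      finally show ?thesis .
    next
      case odd: False
      then obtain m where m: "n = 2*m+1" by (elim oddE)
      have m1: "m \<ge> 1" using False m by auto
      let ?B = "{p. prime p \<and> m + 1 < p \<and> p \<le> n}"
      have fB: "finite ?B" by (rule finite_subset[of _ "{..n}"]) auto
      have split: "{p. prime p \<and> p \<le> n} = {p. prime p \<and> p \<le> m+1} \<union> ?B"
        using m by auto
      have "\<Prod>?B dvd (n choose m)"
      proof (rule prod_primes_dvd[OF fB])
        fix p assume p: "p \<in> ?B"
        have eq: "fact m * fact (n - m) * (n choose m) = (fact n :: nat)"
          using m by (intro binomial_fact_lemma) auto
        have "p dvd (fact n :: nat)" using p by (simp add: prime_dvd_fact_iff)
        then have "p dvd (fact m * fact (n - m) * (n choose m))" by (simp only: eq)
        then have "p dvd fact m \<or> p dvd fact (n - m) \<or> p dvd (n choose m)"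
          using p by (simp only: mem_Collect_eq prime_dvd_mult_iff disj_assoc)
        moreover have "\<not> p dvd (fact m :: nat)" "\<not> p dvd (fact (n-m) :: nat)"
          using p m by (auto simp: prime_dvd_fact_iff simp del: fact_Suc)
        ultimately show "p dvd (n choose m)" by blast
      qed auto
      then have "\<Prod>?B \<le> n choose m" using m by (intro dvd_imp_le) (auto simp: zero_less_binomial_iff)
      also have "\<dots> \<le> 4 ^ m" using middle_binomial_le m by simp
      finally have B: "\<Prod>?B \<le> 4 ^ m" .
      have "\<Prod>{p. prime p \<and> p \<le> n} = \<Prod>{p. prime p \<and> p \<le> m+1} * \<Prod>?B"
        unfolding split by (rule prod.union_disjoint) (use fB in auto)
      also have "\<dots> \<le> 4 ^ (m+1) * 4 ^ m"
        using less[of "m+1"] B m m1 by (intro mult_mono) auto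
      also have "\<dots> = 4 ^ n" using m by (simp add: power_add mult_2)
      finally show ?thesis .
    qed
  qed
qed

lemma sum_ln_primes_le: "(\<Sum>p | prime p \<and> p \<le> n. ln (real p)) \<le> real n * ln 4"
proof -
  have "(\<Sum>p | prime p \<and> p \<le> n. ln (real p)) = ln (\<Prod>p | prime p \<and> p \<le> n. real p)"
    by (subst ln_prod) (auto dest: prime_gt_0_nat)
  also have "(\<Prod>p | prime p \<and> p \<le> n. real p) = real (\<Prod>{p. prime p \<and> p \<le> n})"
    by simp
  also have "ln \<dots> \<le> ln (real (4 ^ n))"
    using primorial_le[of n] prod_pos[of "{p::nat. prime p \<and> p \<le> n}" "\<lambda>p. p"]
    by (subst ln_le_cancel_iff) (auto dest: prime_gt_0_nat simp del: of_nat_prod of_nat_power simp: of_nat_0_less_iff)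
  also have "\<dots> = real n * ln 4" by (simp add: ln_realpow)
  finally show ?thesis .
qed

lemma power_dvd_fact_mult:
  fixes p k :: nat
  assumes "p > 0"
  shows "p ^ k dvd fact (k * p)"
proof (induction k)
  case (Suc k)
  obtain r where r: "Suc k * p = Suc r" "k * p \<le> r"
    using assms by (cases "Suc k * p") auto
  have "(fact (k*p) :: nat) dvd fact r" using r by (simp add: fact_dvd)
  then have "p ^ k dvd (fact r :: nat)" using Suc by (blast intro: dvd_trans)
  moreover have "p dvd Suc r" using r by (metis dvd_triv_right)
  ultimately have "p ^ k * p dvd fact r * Suc r" by (intro mult_dvd_mono)
  then show ?case using r by (simp add: mult_ac)
qed simp

text \<open>One half of Mertens' first theorem, by Legendre's argument: the product of the powers
  \<open>p\<^bsup>n div p\<^esup>\<close> divides \<open>n!\<close>, and replacing \<open>n div p\<close> by \<open>n / p\<close> costs at most the Chebyshev sum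
  \<open>\<Sum>p\<le>n. ln p \<le> n ln 4\<close>.\<close>
lemma sum_ln_over_primes_le:
  assumes "n \<ge> 1"
  shows "(\<Sum>p | prime p \<and> p \<le> n. ln (real p) / real p) \<le> ln (4 * real n)"
proof -
  let ?Q = "{p. prime p \<and> p \<le> n}"
  have "(\<Prod>p\<in>?Q. p ^ (n div p)) dvd fact n"
  proof -
    have "(\<Prod>p\<in>A. p ^ (n div p)) dvd fact n" if "finite A" "A \<subseteq> ?Q" for A
      using that
    proof (induction A rule: finite_induct)
      case (insert p A)
      have "p ^ (n div p) dvd (fact (n div p * p) :: nat)"
        using insert by (intro power_dvd_fact_mult) (auto dest: prime_gt_0_nat)
      also have "\<dots> dvd fact n" by (intro fact_dvd) simp
      finally have "p ^ (n div p) dvd fact n" .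
      moreover have "coprime (p ^ (n div p)) (\<Prod>p\<in>A. p ^ (n div p))"
        using insert by (intro prod_coprime_right coprime_power_left_iff[THEN iffD2] disjI1
            coprime_power_right_iff[THEN iffD2]) (auto intro: primes_coprime)
      ultimately show ?case using insert by (auto intro: divides_mult)
    qed simp
    then show ?thesis by (simp)
  qed
  then have le: "(\<Prod>p\<in>?Q. p ^ (n div p)) \<le> fact n" by (rule dvd_imp_le) simp
  also have "\<dots> \<le> n ^ n" using fact_le_power[of n, where 'a = nat] by simp
  finally have le: "real (\<Prod>p\<in>?Q. p ^ (n div p)) \<le> real (n ^ n)" by (simp only: of_nat_le_iff)
  have "(\<Sum>p\<in>?Q. real (n div p) * ln (real p)) = ln (\<Prod>p\<in>?Q. real p ^ (n div p))"
    by (subst ln_prod) (auto dest: prime_gt_0_nat simp: ln_realpow)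
  also have "\<dots> \<le> ln (real n ^ n)"
    using le assms by (subst ln_le_cancel_iff) (auto intro!: prod_pos dest: prime_gt_0_nat)
  also have "\<dots> = real n * ln (real n)" using assms by (simp add: ln_realpow)
  finally have 1: "(\<Sum>p\<in>?Q. real (n div p) * ln (real p)) \<le> real n * ln (real n)" .
  have "real n * (\<Sum>p\<in>?Q. ln (real p) / real p) = (\<Sum>p\<in>?Q. (real n / real p) * ln (real p))"
    by (simp add: sum_distrib_left)
  also have "\<dots> \<le> (\<Sum>p\<in>?Q. (real (n div p) + 1) * ln (real p))"
  proof (intro sum_mono mult_right_mono)
    fix p assume p: "p \<in> ?Q"
    then have "p > 0" by (auto dest: prime_gt_0_nat)
    have "real n = real (n div p) * real p + real (n mod p)"
      by (metis div_mult_mod_eq of_nat_add of_nat_mult)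
    moreover have "real (n mod p) \<le> real p" using \<open>p>0\<close> by (simp add: less_imp_le)
    ultimately show "real n / real p \<le> real (n div p) + 1" using \<open>p > 0\<close>
      by (simp add: field_simps)
    show "0 \<le> ln (real p)" using \<open>p > 0\<close> by simp
  qed
  also have "\<dots> = (\<Sum>p\<in>?Q. real (n div p) * ln (real p)) + (\<Sum>p\<in>?Q. ln (real p))"
    by (simp add: algebra_simps sum.distrib)
  also have "\<dots> \<le> real n * ln (real n) + real n * ln 4"
    using 1 sum_ln_primes_le[of n] by linarith
  also have "\<dots> = real n * ln (4 * real n)" using assms by (simp add: ln_mult algebra_simps)
  finally show ?thesis using assms by simp
qed

text \<open>The map \<open>p \<mapsto> (p - 1) div 2\<close> is injective on primes, because it separates odd numbers and sends
  only the even prime to \<open>0\<close>.\<close>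
lemma card_primes_le_half: "n \<ge> 1 \<Longrightarrow> real (card {p::nat. prime p \<and> p \<le> n}) \<le> (real n + 1) / 2"
proof -
  assume n: "n \<ge> 1"
  have "card {p::nat. prime p \<and> p \<le> n} \<le> card {0..(n-1) div 2}"
  proof (rule card_inj_on_le[where f = "\<lambda>p. (p-1) div 2"])
    show "inj_on (\<lambda>p. (p-1) div 2) {p::nat. prime p \<and> p \<le> n}"
    proof (rule inj_onI)
      fix p q :: nat
      assume "p \<in> {p::nat. prime p \<and> p \<le> n}" "q \<in> {p::nat. prime p \<and> p \<le> n}" "(p-1) div 2 = (q-1) div 2"
      then have "p \<ge> 2" "q \<ge> 2" "p = 2 \<or> odd p" "q = 2 \<or> odd q"
        and eq: "(p-1) div 2 = (q-1) div 2"
        using prime_odd_nat prime_ge_2_nat by (auto simp: le_less)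
      have "p = 2 * ((p-1) div 2) + (if odd p then 1 else 2)" if "p \<ge> 2" for p :: nat
        using that by (auto elim!: evenE oddE)
      from this[OF \<open>p \<ge> 2\<close>] this[OF \<open>q \<ge> 2\<close>] eq have "odd p = odd q \<Longrightarrow> p = q" by metis
      moreover have "(r-1) div 2 \<ge> 1" if "odd r" "r \<ge> 2" for r :: nat
        using that by (auto elim!: oddE)
      then have "odd p = odd q"
        using \<open>p = 2 \<or> odd p\<close> \<open>q = 2 \<or> odd q\<close> \<open>p \<ge> 2\<close> \<open>q \<ge> 2\<close> eq by fastforce
      ultimately show "p = q" by blast
    qed
    show "(\<lambda>p. (p-1) div 2) ` {p::nat. prime p \<and> p \<le> n} \<subseteq> {0..(n-1) div 2}"
      by (auto intro!: div_le_mono diff_le_mono)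
  qed simp
  also have "\<dots> = (n-1) div 2 + 1" by simp
  finally have "2 * card {p::nat. prime p \<and> p \<le> n} \<le> n + 1" using n by linarith
  then have "real (2 * card {p::nat. prime p \<and> p \<le> n}) \<le> real (n + 1)" by (simp only: of_nat_le_iff)
  then show ?thesis by simp
qed

lemma primes_upto_floor:
  "N \<ge> 0 \<Longrightarrow> primes_upto N = {p. prime p \<and> p \<le> nat \<lfloor>N\<rfloor>}"
  by (auto simp: primes_upto_def le_nat_iff le_floor_iff)

lemma finite_primes_upto [simp]: "finite (primes_upto N)"
  unfolding primes_upto_def
  by (rule finite_subset[of _ "{..nat \<lfloor>N\<rfloor>}"]) (auto simp: le_nat_floor)

text \<open>The maximum of \<open>L\<^sup>2 exp (- L/4)\<close> is \<open>64 exp (- 2) = 8.66\<dots>\<close>.\<close>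
lemma ln_power2_le:
  assumes "N \<ge> (1::real)"
  shows "(ln N)\<^sup>2 \<le> 8.8 * N powr (1/4)"
proof -
  have "(1 + 1/8 + (1/8)\<^sup>2 / 2) ^ 8 \<le> exp (1/8::real) ^ 8"
    by (intro power_mono exp_lower_Taylor_quadratic) auto
  also have "\<dots> = exp 1" by (simp flip: exp_of_nat_mult)
  finally have e: "exp (1::real) \<ge> 2.7" by (simp add: power2_eq_square eval_nat_numeral)
  define L where "L = ln N"
  have L: "L \<ge> 0" using assms by (simp add: L_def)
  have "1 + (L/8 - 1) \<le> exp (L/8 - 1)" by (rule exp_ge_add_one_self)
  also have "\<dots> = exp (L/8) / exp 1" by (simp add: exp_diff)
  also have "\<dots> \<le> exp (L/8) / 2.7" using e by (intro divide_left_mono) auto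
  finally have "L \<le> 8 / 2.7 * exp (L/8)" by simp
  then have "L\<^sup>2 \<le> (8 / 2.7 * exp (L/8))\<^sup>2" using L by (intro power_mono) auto
  also have "\<dots> = (8/2.7)\<^sup>2 * exp (L/4)" by (simp add: power_mult_distrib power2_eq_square flip: exp_add)
  also have "\<dots> \<le> 8.8 * exp (L/4)" by (intro mult_right_mono) (auto simp: power2_eq_square)
  also have "exp (L/4) = N powr (1/4)" using assms by (simp add: powr_def L_def)
  finally show ?thesis by (simp add: L_def)
qed

text \<open>The primes above \<open>N\<^bsup>3/4\<^esup>\<close> have logarithm at least \<open>(3/4) ln N\<close>, so \<open>\<Sum>p\<le>N. ln p \<le> N ln 4\<close> bounds their
  number by \<open>(4/3) (ln 4) N / ln N\<close>; the others are at most \<open>(N\<^bsup>3/4\<^esup> + 1) / 2\<close>, which is of lower order.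
  The exponent \<open>3/4\<close> keeps the leading constant below 2, the value that makes \<open>f \<le> 1\<close> for large \<open>N\<close>.\<close>
lemma card_primes_upto_le:
  assumes N: "N \<ge> 1000"
  shows "real (card (primes_upto N)) \<le> N / ln N * (1.852 + 4.5 / ln N)"
proof -
  define w where "w = N powr (3/4)"
  define L where "L = ln N"
  have L: "L > 0" using N by (simp add: L_def)
  have Npos: "N > 0" using N by simp
  have lnw: "ln w = 3/4 * L" using Npos by (simp add: w_def L_def ln_powr)
  have w100: "w \<ge> 100"
  proof -
    have "100 = ((10::real) powr 3) powr (2/3)" by (simp add: powr_powr powr_numeral del: powr_numeral)
    also have "\<dots> = 1000 powr (2/3)" by simp
    also have "\<dots> \<le> 1000 powr (3/4)" by (intro powr_mono) auto
    also have "\<dots> \<le> w" unfolding w_def using N by (intro powr_mono2) auto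
    finally show ?thesis .
  qed
  have wN: "w \<le> N" unfolding w_def using N powr_mono[of "3/4" 1 N] by simp
  let ?A = "primes_upto w" and ?B = "primes_upto N - primes_upto w"
  have cardA: "real (card ?A) \<le> (w + 1) / 2"
  proof -
    have "real (card ?A) \<le> (real (nat \<lfloor>w\<rfloor>) + 1) / 2"
      using card_primes_le_half[of "nat \<lfloor>w\<rfloor>"] w100 by (simp add: primes_upto_floor le_nat_floor)
    also have "\<dots> \<le> (w + 1) / 2" using w100 by simp
    finally show ?thesis .
  qed
  have "real (card ?B) * (3/4 * L) = (\<Sum>p\<in>?B. ln w)" by (simp add: lnw)
  also have "\<dots> \<le> (\<Sum>p\<in>?B. ln (real p))"
    using w100 by (intro sum_mono) (auto simp: primes_upto_def not_le)
  also have "\<dots> \<le> (\<Sum>p\<in>primes_upto N. ln (real p))"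
    by (rule sum_mono2, rule finite_primes_upto) (auto simp: primes_upto_def dest: prime_ge_1_nat)
  also have "\<dots> \<le> real (nat \<lfloor>N\<rfloor>) * ln 4"
    using N sum_ln_primes_le[of "nat \<lfloor>N\<rfloor>"] by (simp only: primes_upto_floor)
  also have "\<dots> \<le> N * ln 4" using N by (intro mult_right_mono) auto
  also have "ln (4::real) = 2 * ln 2" using ln_realpow[of 2 2] by simp
  also have "N * (2 * ln 2) \<le> N * (2 * (25/36))"
    using ln2_le_25_over_36 N by (intro mult_left_mono) auto
  finally have "real (card ?B) \<le> N * (50/36) / (3/4 * L)" using L by (simp add: field_simps)
  also have "\<dots> \<le> N / L * 1.852" using L N by (simp add: field_simps)
  finally have B: "real (card ?B) \<le> N / L * 1.852" .
  have "primes_upto N = ?A \<union> ?B" using wN by (auto simp: primes_upto_def)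
  then have "card (primes_upto N) = card ?A + card ?B"
    by (metis card_Un_disjoint Diff_disjoint finite_Diff finite_primes_upto)
  then have *: "real (card (primes_upto N)) \<le> N / L * 1.852 + (w+1)/2" using B cardA by linarith
  have Npow: "N powr (1/4) * w = N" unfolding w_def using Npos by (simp flip: powr_add)
  have "L\<^sup>2 * (w + 1) \<le> 8.8 * N powr (1/4) * (w * 1.01)"
    using ln_power2_le[of N] N w100 by (intro mult_mono) (auto simp: L_def)
  also have "\<dots> = 8.888 * (N powr (1/4) * w)" by simp
  also have "\<dots> \<le> 9 * N" using Npow Npos by simp
  finally have "(w+1)/2 \<le> N / L * (4.5 / L)" using L by (simp add: field_simps power2_eq_square)
  with * have "real (card (primes_upto N)) \<le> N / L * 1.852 + N / L * (4.5 / L)" by linarith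
  then show ?thesis unfolding L_def[symmetric] by (simp only: distrib_left)
qed

section \<open>Reciprocal sums over squarefree numbers\<close>

lemma sum_Pow_insert:
  assumes "finite A" "x \<in> A"
  shows "(\<Sum>X | X \<subseteq> A \<and> x \<in> X. (\<Prod>i\<in>X. g i)) = (g x :: real) * (\<Sum>X\<in>Pow (A - {x}). (\<Prod>i\<in>X. g i))"
proof -
  have "(\<Sum>X | X \<subseteq> A \<and> x \<in> X. (\<Prod>i\<in>X. g i)) = (\<Sum>X\<in>Pow (A - {x}). (\<Prod>i\<in>insert x X. g i))"
    by (rule sum.reindex_bij_witness[of _ "insert x" "\<lambda>X. X - {x}"])
       (use assms in \<open>auto simp: insert_absorb\<close>)
  also have "\<dots> = (\<Sum>X\<in>Pow (A - {x}). g x * (\<Prod>i\<in>X. g i))"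
    using assms by (intro sum.cong refl prod.insert) (auto intro: finite_subset)
  finally show ?thesis by (simp add: sum_distrib_left)
qed

lemma prod_one_plus:
  assumes "finite A"
  shows "(\<Prod>x\<in>A. 1 + (g x :: real)) = (\<Sum>X\<in>Pow A. (\<Prod>i\<in>X. g i))"
  using prod_add[OF assms, of g "\<lambda>_. 1"] by (simp add: add.commute)

lemma prod_primes_inject:
  fixes A B :: "nat set"
  assumes "finite A" "finite B" "\<And>p. p \<in> A \<union> B \<Longrightarrow> prime p" "\<Prod>A = \<Prod>B"
  shows "A = B"
proof -
  have "p \<in> A \<longleftrightarrow> prime p \<and> p dvd \<Prod>A" if "finite A" "\<And>p. p \<in> A \<Longrightarrow> prime p" for p and A :: "nat set"
    using that by (auto simp: prime_dvd_prod_iff) (metis primes_dvd_imp_eq)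
  then have "A = {p. prime p \<and> p dvd \<Prod>A}" "B = {p. prime p \<and> p dvd \<Prod>B}"
    using assms(1-3) by blast+
  then show ?thesis by (rule box_equals[OF _ sym sym, rotated]) (simp only: assms(4))
qed

text \<open>Expand the product into \<open>\<Sum> 1/q\<close> over squarefree \<open>q\<close> with prime factors at most \<open>Z\<close>.  With respect to
  the weights \<open>1/q\<close> the mean value of \<open>ln q\<close> is at most \<open>\<Sum>p\<le>Z. ln p / p \<le> ln (4Z)\<close>.  By Markov's inequality
  at least half of the weight lies on \<open>q \<le> (4Z)\<^sup>2\<close>, where it is bounded by a harmonic sum.  The
  point is that the bound is linear in \<open>ln Z\<close>.\<close>
lemma prod_one_plus_inverse_primes_le:
  fixes Z :: nat
  assumes Z: "Z \<ge> 1"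
  shows "(\<Prod>p | prime p \<and> p \<le> Z. 1 + 1 / real p) \<le> 2 + 4 * ln (4 * real Z)"
proof -
  let ?Q = "{p. prime p \<and> p \<le> Z}"
  let ?w = "\<lambda>A. \<Prod>p\<in>A. 1 / real p"
  define M where "M = (\<Prod>p\<in>?Q. 1 + 1 / real p)"
  define T where "T = ln (4 * real Z)"
  have T: "T > 0" using Z by (simp add: T_def)
  have M_eq: "M = (\<Sum>A\<in>Pow ?Q. ?w A)" unfolding M_def by (rule prod_one_plus) simp
  have w0: "?w A \<ge> 0" for A by (intro prod_nonneg) auto
  have fin: "finite A" if "A \<in> Pow ?Q" for A using that finite_primes_le by (auto intro: finite_subset)
  have M0: "M \<ge> 0" unfolding M_def by (intro prod_nonneg) auto
  have "(\<Sum>A\<in>Pow ?Q. ?w A * ln (real (\<Prod>A))) = (\<Sum>A\<in>Pow ?Q. \<Sum>p\<in>?Q. if p \<in> A then ?w A * ln (real p) else 0)"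
  proof (intro sum.cong refl)
    fix A assume A: "A \<in> Pow ?Q"
    have "ln (real (\<Prod>A)) = (\<Sum>p\<in>A. ln (real p))"
      using A fin[OF A] by (subst of_nat_prod, subst ln_prod) (auto dest: prime_gt_0_nat)
    also have "?w A * \<dots> = (\<Sum>p\<in>A. ?w A * ln (real p))" by (rule sum_distrib_left)
    also have "\<dots> = (\<Sum>p\<in>?Q. if p \<in> A then ?w A * ln (real p) else 0)"
      using A sum.inter_restrict[OF finite_primes_le, of _ Z A] by (simp only: Int_absorb1 Pow_iff)
    finally show "?w A * ln (real (\<Prod>A)) = \<dots>" .
  qed
  also have "\<dots> = (\<Sum>p\<in>?Q. \<Sum>A\<in>Pow ?Q. if p \<in> A then ?w A * ln (real p) else 0)"
    by (rule sum.swap)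
  also have "\<dots> \<le> (\<Sum>p\<in>?Q. ln (real p) / real p * M)"
  proof (intro sum_mono)
    fix p assume p: "p \<in> ?Q"
    have "(\<Sum>A\<in>Pow ?Q. if p \<in> A then ?w A * ln (real p) else 0) = (\<Sum>A | A \<subseteq> ?Q \<and> p \<in> A. ?w A * ln (real p))"
      by (subst sum.inter_filter[symmetric]) (auto intro!: sum.cong)
    also have "\<dots> = ln (real p) * (\<Sum>A | A \<subseteq> ?Q \<and> p \<in> A. ?w A)"
      by (simp add: sum_distrib_left mult.commute)
    also have "\<dots> = ln (real p) * (1 / real p * (\<Sum>A\<in>Pow (?Q - {p}). ?w A))"
      by (subst sum_Pow_insert) (use p in auto)
    also have "\<dots> \<le> ln (real p) * (1 / real p * M)"
      unfolding M_eq using p w0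
      by (intro mult_left_mono sum_mono2) (auto dest: prime_ge_1_nat)
    finally show "(\<Sum>A\<in>Pow ?Q. if p \<in> A then ?w A * ln (real p) else 0) \<le> ln (real p) / real p * M" by simp
  qed
  also have "\<dots> = (\<Sum>p\<in>?Q. ln (real p) / real p) * M" by (rule sum_distrib_right[symmetric])
  also have "\<dots> \<le> T * M"
    unfolding T_def by (intro mult_right_mono sum_ln_over_primes_le Z M0)
  finally have mean: "(\<Sum>A\<in>Pow ?Q. ?w A * ln (real (\<Prod>A))) \<le> T * M" .
  define small where "small = {A\<in>Pow ?Q. \<Prod>A \<le> (4*Z)^2}"
  have finsm: "finite small" unfolding small_def by simp
  \<comment> \<open>Markov's inequality: outside \<open>small\<close> the logarithm is at least twice the bound \<open>T\<close> for its mean value.\<close>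
  have "(\<Sum>A\<in>Pow ?Q - small. ?w A) * (2 * T) = (\<Sum>A\<in>Pow ?Q - small. ?w A * (2 * T))"
    by (rule sum_distrib_right)
  also have "\<dots> \<le> (\<Sum>A\<in>Pow ?Q - small. ?w A * ln (real (\<Prod>A)))"
  proof (intro sum_mono mult_left_mono w0)
    fix A assume "A \<in> Pow ?Q - small"
    then have "real ((4*Z)^2) \<le> real (\<Prod>A)" unfolding small_def by (simp only: of_nat_le_iff) auto
    then have "ln (real ((4*Z)^2)) \<le> ln (real (\<Prod>A))" using Z by (intro ln_mono) auto
    moreover have "ln (real ((4*Z)^2)) = 2 * T" using ln_realpow[of "4 * real Z" 2] Z by (simp add: T_def)
    ultimately show "2 * T \<le> ln (real (\<Prod>A))" by simp
  qed
  also have "\<dots> \<le> (\<Sum>A\<in>Pow ?Q. ?w A * ln (real (\<Prod>A)))"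
  proof (intro sum_mono2 mult_nonneg_nonneg w0)
    fix A assume "A \<in> Pow ?Q - (Pow ?Q - small)"
    then have "\<Prod>A > 0" by (intro prod_pos) (auto dest: prime_gt_0_nat)
    then have "1 \<le> \<Prod>A" by simp
    then have "1 \<le> real (\<Prod>A)" by (metis of_nat_1 of_nat_le_iff)
    then show "0 \<le> ln (real (\<Prod>A))" by (rule ln_ge_zero)
  qed auto
  also note mean
  finally have large: "(\<Sum>A\<in>Pow ?Q - small. ?w A) \<le> M / 2" using T by (simp add: field_simps)
  have "(\<Sum>A\<in>small. ?w A) = (\<Sum>A\<in>small. 1 / real (\<Prod>A))"
    by (simp add: prod_dividef)
  also have "\<dots> = (\<Sum>n\<in>Prod ` small. 1 / real n)"
  proof (subst sum.reindex)
    show "inj_on Prod small"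
    proof (rule inj_onI)
      fix A B assume "A \<in> small" "B \<in> small" "\<Prod>A = \<Prod>B"
      then show "A = B" using fin[of A] fin[of B]
        by (intro prod_primes_inject) (auto simp: small_def)
    qed
  qed simp
  also have "\<dots> \<le> (\<Sum>n=1..(4*Z)^2. 1 / real n)"
  proof (intro sum_mono2)
    have pos: "\<Prod>A > 0" if "A \<in> small" for A
      using that by (intro prod_pos) (auto simp: small_def dest: prime_gt_0_nat)
    show "Prod ` small \<subseteq> {1..(4*Z)^2}"
    proof (rule image_subsetI)
      fix A assume "A \<in> small"
      then show "\<Prod>A \<in> {1..(4*Z)^2}" using pos[of A] by (simp add: small_def)
    qed
  qed auto
  also have "\<dots> = harm ((4*Z)^2)" by (simp add: harm_def inverse_eq_divide)
  also have "\<dots> \<le> 1 + ln (real ((4*Z)^2))"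
  proof -
    have "harm ((4*Z)^2) - ln (real ((4*Z)^2)) \<le> harm 1 - ln (real 1)"
      by (rule euler_mascheroni_sequence_decreasing) (use Z in auto)
    moreover have "harm 1 = (1::real)" by (simp add: harm_def)
    ultimately show ?thesis by (simp only: of_nat_1 ln_one)
  qed
  also have "\<dots> = 1 + 2 * T" using ln_realpow[of "4 * real Z" 2] Z by (simp add: T_def)
  finally have "(\<Sum>A\<in>small. ?w A) \<le> 1 + 2 * T" .
  moreover have "M = (\<Sum>A\<in>small. ?w A) + (\<Sum>A\<in>Pow ?Q - small. ?w A)"
    unfolding M_eq by (subst add.commute, rule sum.subset_diff) (auto simp: small_def)
  ultimately have "M \<le> 2 + 4 * T" using large by linarith
  then show ?thesis by (simp only: M_def T_def)
qed

lemma sum_inverse_squares_le: "(\<Sum>m=1..n. 1 / (real m)\<^sup>2) \<le> 2"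
proof -
  have "(\<Sum>m=1..n. 1 / (real m)\<^sup>2) \<le> 2 - 1 / real n" if "n \<ge> 1"
    using that
  proof (induction n rule: dec_induct)
    case (step n)
    have "1 / (real (Suc n))\<^sup>2 \<le> 1 / (real n * real (Suc n))"
      using step by (intro divide_left_mono) (auto simp: power2_eq_square)
    also have "\<dots> = 1 / real n - 1 / real (Suc n)" using step by (simp add: field_simps)
    finally show ?case using step by simp
  qed simp
  moreover have "1 / real n \<ge> 0" by simp
  ultimately show ?thesis by (cases "n \<ge> 1") (linarith, simp)
qed

lemma prod_prime_factors_squarefree:
  assumes "squarefree (n::nat)" "n > 0"
  shows "\<Prod>(prime_factors n) = n"
proof -
  have "n = (\<Prod>p\<in>prime_factors n. p ^ multiplicity p n)" using assms by (simp add: prime_factorization_nat)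
  also have "\<dots> = (\<Prod>p\<in>prime_factors n. p)"
    using assms squarefree_factorial_semiring'[of n] by (intro prod.cong) auto
  finally show ?thesis by simp
qed

text \<open>Write every \<open>k \<le> z\<close> as a squarefree number times a square: the harmonic sum, which is at least \<open>ln z\<close>, is at
  most the sum over squarefree numbers times \<open>\<Sum> 1/m\<^sup>2 \<le> 2\<close>.\<close>
lemma sum_squarefree_ge:
  assumes z: "z \<ge> 1"
  shows "ln z \<le> 2 * (\<Sum>A | A \<subseteq> primes_upto z \<and> real (\<Prod>A) \<le> z. 1 / real (\<Prod>A))"
proof -
  define n where "n = nat \<lfloor>z\<rfloor>"
  have n_iff: "k \<le> n \<longleftrightarrow> real k \<le> z" for k using z unfolding n_def by (simp add: le_nat_iff le_floor_iff)
  let ?T = "{A. A \<subseteq> primes_upto z \<and> real (\<Prod>A) \<le> z}"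
  let ?f = "\<lambda>k. (prime_factors (squarefree_part k), square_part k)"
  have dec: "\<Prod>(prime_factors (squarefree_part k)) * (square_part k)\<^sup>2 = k" "squarefree_part k > 0" "square_part k > 0"
    if "k \<ge> 1" for k :: nat
  proof -
    have "squarefree_part k \<noteq> 0" by (rule squarefree_part_nonzero)
    then show "squarefree_part k > 0" by (rule bot_nat_0.not_eq_extremum[THEN iffD1])
    then have "\<Prod>(prime_factors (squarefree_part k)) = squarefree_part k"
      by (intro prod_prime_factors_squarefree squarefree_squarefree_part)
    then show "\<Prod>(prime_factors (squarefree_part k)) * (square_part k)\<^sup>2 = k"
      using squarefree_decompose[of k] by simp
    show "square_part k > 0" using that by (intro gr0I) simp
  qed
  have finT: "finite ?T" by (rule finite_subset[of _ "Pow (primes_upto z)"]) auto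
  have "z \<le> real n + 1" unfolding n_def using z by linarith
  then have "ln z \<le> ln (real n + 1)" using z by simp
  also have "\<dots> \<le> harm n" by (rule ln_le_harm)
  also have "\<dots> = (\<Sum>k=1..n. 1 / real k)" by (simp add: harm_def inverse_eq_divide)
  also have "\<dots> = (\<Sum>k=1..n. (case ?f k of (A, m) \<Rightarrow> 1 / real (\<Prod>A) * (1 / (real m)\<^sup>2)))"
  proof (intro sum.cong refl)
    fix k assume "k \<in> {1..n}"
    then have "real (\<Prod>(prime_factors (squarefree_part k)) * (square_part k)\<^sup>2) = real k" using dec(1)[of k] by simp
    then show "1 / real k = (case ?f k of (A, m) \<Rightarrow> 1 / real (\<Prod>A) * (1 / (real m)\<^sup>2))"
      by (simp del: of_nat_prod)
  qed
  also have "\<dots> = (\<Sum>(A, m)\<in>?f ` {1..n}. 1 / real (\<Prod>A) * (1 / (real m)\<^sup>2))"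
  proof (subst sum.reindex)
    show "inj_on ?f {1..n}"
    proof (rule inj_onI)
      fix k l assume kl: "k \<in> {1..n}" "l \<in> {1..n}" "?f k = ?f l"
      then have "\<Prod>(prime_factors (squarefree_part k)) * (square_part k)\<^sup>2 = \<Prod>(prime_factors (squarefree_part l)) * (square_part l)\<^sup>2"
        by simp
      moreover have "k \<ge> 1" "l \<ge> 1" using kl by auto
      ultimately show "k = l" by (simp only: dec(1))
    qed
  qed (simp add: case_prod_beta)
  also have "\<dots> \<le> (\<Sum>(A, m)\<in>?T \<times> {1..n}. 1 / real (\<Prod>A) * (1 / (real m)\<^sup>2))"
  proof (rule sum_mono2)
    show "finite (?T \<times> {1..n})" using finT by simp
    show "?f ` {1..n} \<subseteq> ?T \<times> {1..n}"
    proof (rule image_subsetI)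
      fix k assume k: "k \<in> {1..n}"
      let ?s = "squarefree_part k" and ?q = "square_part k"
      have "\<Prod>(prime_factors ?s) dvd \<Prod>(prime_factors ?s) * ?q\<^sup>2" by simp
      also have "\<dots> = k" using k by (intro dec(1)) simp
      finally have "\<Prod>(prime_factors ?s) dvd k" .
      then have 1: "\<Prod>(prime_factors ?s) \<le> n" using k by (auto dest: dvd_imp_le)
      have "?s dvd ?s * ?q\<^sup>2" by simp
      also have "\<dots> = k" by (rule squarefree_decompose[symmetric])
      finally have "?s dvd k" .
      then have "p \<le> n" if "p \<in> prime_factors ?s" for p
      proof -
        have "p dvd k" using that \<open>?s dvd k\<close> by (auto intro: dvd_trans)
        then have "p \<le> k" using k by (intro dvd_imp_le) auto
        then show ?thesis using k by simp
      qed
      then have 2: "prime_factors ?s \<subseteq> primes_upto z" by (auto simp: primes_upto_def n_iff)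
      have "?q dvd ?q\<^sup>2" by (simp add: power2_eq_square)
      then have "?q dvd k" using square_part_square_dvd by (rule dvd_trans)
      then have "?q \<le> n" using k by (auto dest: dvd_imp_le)
      then show "?f k \<in> ?T \<times> {1..n}" using 1 2 dec(3)[of k] k n_iff[of "\<Prod>(prime_factors ?s)"] by (simp add: Suc_le_eq)
    qed
  qed (auto intro!: divide_nonneg_nonneg mult_nonneg_nonneg simp: prod_nonneg)
  also have "\<dots> = (\<Sum>A\<in>?T. 1 / real (\<Prod>A)) * (\<Sum>m=1..n. 1 / (real m)\<^sup>2)"
    by (simp only: sum_product sum.cartesian_product)
  also have "\<dots> \<le> (\<Sum>A\<in>?T. 1 / real (\<Prod>A)) * 2"
    by (intro mult_left_mono sum_inverse_squares_le sum_nonneg) (simp add: prod_nonneg)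
  finally show ?thesis by simp
qed

text \<open>Split each squarefree \<open>q \<le> z\<close> into its part with prime factors up to \<open>Z\<close> and the rest.  The first part
  contributes at most \<open>\<Prod>p\<le>Z. (1 + 1/p) = O(ln (4Z))\<close>, so the second carries at least a constant times
  \<open>ln z / ln (4Z)\<close>.\<close>
lemma presieved_sum_ge:
  fixes Z :: nat
  assumes z: "z \<ge> 1" and Z: "Z \<ge> 1"
  shows "ln z \<le> (4 + 8 * ln (4 * real Z)) *
     (\<Sum>A | A \<subseteq> {p \<in> primes_upto z. Z < p} \<and> real (\<Prod>A) \<le> z. \<Prod>p\<in>A. 1 / (real p - 1))"
proof -
  let ?w = "\<lambda>A. \<Prod>p\<in>A. 1 / real p"
  let ?T = "{A. A \<subseteq> primes_upto z \<and> real (\<Prod>A) \<le> z}"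
  let ?Q = "{p. prime p \<and> p \<le> Z}"
  let ?S = "{A. A \<subseteq> {p \<in> primes_upto z. Z < p} \<and> real (\<Prod>A) \<le> z}"
  let ?f = "\<lambda>A. (A \<inter> {..Z}, A \<inter> {Z<..})"
  have finS: "finite ?S" by (rule finite_subset[of _ "Pow (primes_upto z)"]) auto
  have fin: "finite A" if "A \<subseteq> primes_upto z" for A using that finite_primes_upto by (rule finite_subset)
  have AA: "A = A \<inter> {..Z} \<union> A \<inter> {Z<..}" for A :: "nat set" by auto
  have w0: "?w A \<ge> 0" for A by (intro prod_nonneg) auto
  have "(\<Sum>A\<in>?T. 1 / real (\<Prod>A)) = (\<Sum>A\<in>?T. case ?f A of (B, C) \<Rightarrow> ?w B * ?w C)"
  proof (intro sum.cong refl)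
    fix A assume A: "A \<in> ?T"
    have "1 / real (\<Prod>A) = ?w A" by (simp add: prod_dividef)
    also have "\<dots> = ?w (A \<inter> {..Z}) * ?w (A \<inter> {Z<..})"
      using fin[of A] A by (subst AA[of A], intro prod.union_disjoint) auto
    finally show "1 / real (\<Prod>A) = (case ?f A of (B, C) \<Rightarrow> ?w B * ?w C)" by simp
  qed
  also have "\<dots> = (\<Sum>(B, C)\<in>?f ` ?T. ?w B * ?w C)"
  proof (subst sum.reindex)
    show "inj_on ?f ?T"
    proof (rule inj_onI)
      fix A B assume "?f A = ?f B"
      then have "A \<inter> {..Z} \<union> A \<inter> {Z<..} = B \<inter> {..Z} \<union> B \<inter> {Z<..}" by simp
      then show "A = B" by (simp only: AA[symmetric])
    qed
  qed simp
  also have "\<dots> \<le> (\<Sum>(B, C)\<in>Pow ?Q \<times> ?S. ?w B * ?w C)"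
  proof (rule sum_mono2)
    show "finite (Pow ?Q \<times> ?S)" using finS by simp
    show "?f ` ?T \<subseteq> Pow ?Q \<times> ?S"
    proof (rule image_subsetI)
      fix A assume A: "A \<in> ?T"
      have pos: "\<Prod>A > 0" using A by (intro prod_pos) (auto simp: primes_upto_def dest: prime_gt_0_nat)
      have "\<Prod>(A \<inter> {Z<..}) dvd \<Prod>A" using fin[of A] A by (intro prod_dvd_prod_subset) auto
      then have "\<Prod>(A \<inter> {Z<..}) \<le> \<Prod>A" using pos by (rule dvd_imp_le)
      then have "real (\<Prod>(A \<inter> {Z<..})) \<le> z" using A by (simp only: mem_Collect_eq) (meson of_nat_le_iff order_trans)
      then show "?f A \<in> Pow ?Q \<times> ?S" using A by (auto simp: primes_upto_def)
    qed
  qed (auto intro!: mult_nonneg_nonneg w0)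
  also have "\<dots> = (\<Sum>B\<in>Pow ?Q. ?w B) * (\<Sum>C\<in>?S. ?w C)"
    by (simp only: sum_product sum.cartesian_product)
  also have "(\<Sum>B\<in>Pow ?Q. ?w B) = (\<Prod>p\<in>?Q. 1 + 1 / real p)"
    by (rule prod_one_plus[symmetric]) simp
  also have "\<dots> * (\<Sum>C\<in>?S. ?w C) \<le> (2 + 4 * ln (4 * real Z)) * (\<Sum>C\<in>?S. \<Prod>p\<in>C. 1 / (real p - 1))"
  proof (intro mult_mono prod_one_plus_inverse_primes_le Z sum_mono prod_mono conjI)
    fix C p assume "C \<in> ?S" "p \<in> C"
    then have "p \<ge> 2" by (auto simp: primes_upto_def dest: prime_ge_2_nat)
    then show "1 / real p \<le> 1 / (real p - 1)" "0 \<le> 1 / real p" by (auto intro!: divide_left_mono)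
  next
    show "0 \<le> 2 + 4 * ln (4 * real Z)" using Z by simp
    show "0 \<le> (\<Sum>C\<in>?S. ?w C)" by (intro sum_nonneg w0)
  qed
  finally have "(\<Sum>A\<in>?T. 1 / real (\<Prod>A)) \<le> (2 + 4 * ln (4 * real Z)) * (\<Sum>C\<in>?S. \<Prod>p\<in>C. 1 / (real p - 1))" .
  with sum_squarefree_ge[OF z] show ?thesis by (simp add: algebra_simps)
qed

section \<open>Additive characters\<close>

lemma e_circ_add: "e_circ (x + y) = e_circ x * e_circ y"
  by (simp add: e_circ_def distrib_left exp_add)

lemma e_circ_0 [simp]: "e_circ 0 = 1"
  by (simp add: e_circ_def)

lemma norm_e_circ [simp]: "cmod (e_circ x) = 1"
  unfolding e_circ_def by (simp add: norm_exp_eq_Re)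

lemma e_circ_minus: "e_circ (- x) = cnj (e_circ x)"
  by (simp add: e_circ_def exp_cnj)

lemma e_circ_eq_1_iff: "e_circ x = 1 \<longleftrightarrow> x \<in> \<int>"
proof -
  have "e_circ x = 1 \<longleftrightarrow> (\<exists>n::int. 2 * pi * x = of_int (2 * n) * pi)"
    by (simp add: e_circ_def exp_eq_1)
  also have "\<dots> \<longleftrightarrow> (\<exists>n::int. x = of_int n)" by (simp add: mult_ac)
  finally show ?thesis by (auto simp: Ints_def)
qed

lemma e_circ_of_int [simp]: "e_circ (of_int n) = 1"
  by (simp add: e_circ_eq_1_iff)

lemma e_circ_add_int [simp]: "e_circ (x + of_int n) = e_circ x"
  by (simp add: e_circ_add)

lemma e_circ_power: "e_circ (real j * x) = e_circ x ^ j"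
  by (induction j) (simp_all add: algebra_simps e_circ_add)

lemma sum_e_circ_roots:
  fixes n :: int and m :: nat
  assumes "m > 0"
  shows "(\<Sum>j<m. e_circ (of_int n * real j / real m)) = (if int m dvd n then of_nat m else 0)"
proof -
  let ?r = "e_circ (of_int n / real m)"
  have eq: "e_circ (of_int n * real j / real m) = ?r ^ j" for j
    by (simp flip: e_circ_power add: mult_ac)
  have iff: "?r = 1 \<longleftrightarrow> int m dvd n"
  proof
    assume "?r = 1"
    then obtain q where "of_int n / real m = of_int q" by (auto simp: e_circ_eq_1_iff Ints_def)
    then have "real_of_int n = real_of_int (int m * q)" using assms by (simp add: field_simps)
    then show "int m dvd n" by (simp only: of_int_eq_iff dvd_triv_left)
  next
    assume "int m dvd n"
    then show "?r = 1" using assms by (auto elim!: dvdE simp: e_circ_eq_1_iff)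
  qed
  have "?r ^ m = 1" using assms by (simp flip: e_circ_power)
  then have "(\<Sum>j<m. ?r ^ j) = (if ?r = 1 then of_nat m else 0)"
    by (simp add: sum_gp_strict)
  then show ?thesis unfolding eq iff .
qed

lemma sum_periodic_shift:
  fixes f :: "int \<Rightarrow> 'a::comm_monoid_add"
  assumes "P > 0" "\<And>k. f (k mod P) = f k"
  shows "(\<Sum>k\<in>{0..<P}. f (k + a)) = (\<Sum>k\<in>{0..<P}. f k)"
proof -
  have "(\<Sum>k\<in>{0..<P}. f (k + a)) = (\<Sum>k\<in>{0..<P}. f ((k + a) mod P))" by (simp add: assms(2))
  also have "\<dots> = (\<Sum>k\<in>{0..<P}. f k)"
    by (rule sum.reindex_bij_witness[of _ "\<lambda>k. (k - a) mod P" "\<lambda>k. (k + a) mod P"])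
       (use assms in \<open>auto simp: mod_simps\<close>)
  finally show ?thesis .
qed

section \<open>A Selberg sieve without small primes\<close>

text \<open>Squarefree moduli are represented by the sets of their prime factors, and the fractions with such
  denominators by \<open>k / P\<close> with \<open>k\<close> modulo \<open>P\<close>.  The reduced denominator of \<open>k / P\<close> is the product of
  \<open>supp k\<close>, which turns statements about Farey fractions into statements about residues modulo \<open>P\<close>.\<close>
locale prime_sieve =
  fixes \<P> :: "nat set" and z :: real
  assumes finite_P [simp]: "finite \<P>" and prime_P: "\<And>l. l \<in> \<P> \<Longrightarrow> prime l"
begin

definition P :: nat where "P = \<Prod>\<P>"

definition supp :: "int \<Rightarrow> nat set" where "supp k = {l \<in> \<P>. \<not> int l dvd k}"

text \<open>The coefficient \<open>\<mu>(q) / \<phi>(q)\<close> at the fraction \<open>k / P\<close> of reduced denominator \<open>q\<close>,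
  truncated to \<open>q \<le> z\<close>.\<close>
definition c :: "int \<Rightarrow> real" where
  "c k = (if real (\<Prod>(supp k)) \<le> z then \<Prod>l\<in>supp k. - 1 / (real l - 1) else 0)"

definition G :: real where
  "G = (\<Sum>A | A \<subseteq> \<P> \<and> real (\<Prod>A) \<le> z. \<Prod>l\<in>A. 1 / (real l - 1))"

definition \<nu> :: "int \<Rightarrow> complex" where
  "\<nu> n = (\<Sum>k\<in>{0..<int P}. of_real (c k) * e_circ (of_int n * of_int k / real P))"

text \<open>The Fourier coefficients of \<open>|\<nu>|\<^sup>2\<close>, see \<open>\<nu>_squared\<close>.\<close>
definition W :: "int \<Rightarrow> real" where
  "W y = (\<Sum>k\<in>{0..<int P}. c k * c (k + y))"

lemma supp_subset: "supp k \<subseteq> \<P>" by (auto simp: supp_def)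

lemma finite_sub: "A \<subseteq> \<P> \<Longrightarrow> finite A"
  using finite_P finite_subset by blast

lemma finite_supp [simp]: "finite (supp k)" by (rule finite_sub[OF supp_subset])

lemma prime_ge2: "l \<in> \<P> \<Longrightarrow> l \<ge> 2" using prime_P by (auto dest: prime_ge_2_nat)

lemma prod_pos_sub: "A \<subseteq> \<P> \<Longrightarrow> \<Prod>A > (0::nat)"
  by (rule prod_pos) (use prime_ge2 in force)

lemma P_pos: "P > 0" unfolding P_def by (rule prod_pos_sub) simp

lemma prod_split: "A \<subseteq> \<P> \<Longrightarrow> P = \<Prod>A * \<Prod>(\<P> - A)"
  unfolding P_def by (simp add: prod.subset_diff[of A \<P>] mult.commute)

lemma dvd_P: "l \<in> \<P> \<Longrightarrow> l dvd P"
  unfolding P_def by (rule dvd_prodI) simp_all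

lemma prod_dvd_iff:
  assumes "A \<subseteq> \<P>"
  shows "int (\<Prod>A) dvd k \<longleftrightarrow> (\<forall>l\<in>A. int l dvd k)"
proof -
  have "finite A" using assms by (rule finite_sub)
  then show ?thesis using assms
  proof (induction A rule: finite_induct)
    case (insert l A)
    have "coprime l (\<Prod>A)"
      using insert prime_P by (intro prod_coprime_right primes_coprime) auto
    then have "int (l * \<Prod>A) dvd k \<longleftrightarrow> int l dvd k \<and> int (\<Prod>A) dvd k"
      by (auto simp: divides_mult simp del: of_nat_prod dest: dvd_mult_left dvd_mult_right)
    then show ?case using insert by simp
  qed simp
qed

lemma supp_mod [simp]: "supp (k mod int P) = supp k"
  by (auto simp: supp_def dvd_mod_iff dvd_P)

lemma supp_mod_add [simp]: "supp (k mod int P + y) = supp (k + y)"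
  using supp_mod[of "k mod int P + y"] supp_mod[of "k + y"] by (simp add: mod_simps)

lemma c_mod [simp]: "c (k mod int P) = c k" "c (k mod int P + y) = c (k + y)"
  by (simp_all add: c_def)

text \<open>The Ramanujan sum of modulus \<open>\<Prod>A\<close>, evaluated by inclusion and exclusion over the primes of \<open>A\<close>:
  the sum over all \<open>k\<close> divisible by a given divisor of \<open>P\<close> is a full sum over roots of unity.\<close>
lemma sum_exact_support:
  fixes n :: int
  assumes A: "A \<subseteq> \<P>"
  shows "(\<Sum>k | k \<in> {0..<int P} \<and> supp k = A. e_circ (of_int n * of_int k / real P)) =
         (\<Prod>l\<in>A. (if int l dvd n then of_nat l else 0) - 1)"
proof -
  let ?F = "\<lambda>k. e_circ (of_int n * of_int k / real P)"
  let ?K = "{0..<int P}"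
  have fA: "finite A" using A by (rule finite_sub)
  have ind: "of_bool (supp k = A) =
      (\<Sum>B\<in>Pow A. (-1) ^ card B * of_bool (int (\<Prod>((\<P> - A) \<union> B)) dvd k) :: complex)" for k
  proof -
    have "of_bool (supp k = A) = of_bool (\<forall>l\<in>\<P> - A. int l dvd k) * (\<Prod>l\<in>A. - of_bool (int l dvd k) + (1::complex))"
    proof (cases "(\<forall>l\<in>\<P> - A. int l dvd k) \<and> (\<forall>l\<in>A. \<not> int l dvd k)")
      case True
      then have "supp k = A" using A by (auto simp: supp_def)
      then show ?thesis using True by simp
    next
      case False
      then have "supp k \<noteq> A" by (auto simp: supp_def)
      moreover have "(\<Prod>l\<in>A. - of_bool (int l dvd k) + (1::complex)) = 0" if "\<exists>l\<in>A. int l dvd k"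
        using that fA by (intro prod_zero) auto
      ultimately show ?thesis using False by auto
    qed
    also have "(\<Prod>l\<in>A. - of_bool (int l dvd k) + (1::complex)) = (\<Sum>B\<in>Pow A. (\<Prod>l\<in>B. - of_bool (int l dvd k)))"
      using prod_add[OF fA, of "\<lambda>l. - of_bool (int l dvd k) :: complex" "\<lambda>_. 1"] by simp
    also have "of_bool (\<forall>l\<in>\<P> - A. int l dvd k) * \<dots> =
       (\<Sum>B\<in>Pow A. (-1) ^ card B * of_bool (int (\<Prod>((\<P> - A) \<union> B)) dvd k))"
      unfolding sum_distrib_left
    proof (intro sum.cong refl)
      fix B assume B: "B \<in> Pow A"
      then have fB: "finite B" using fA by (auto intro: finite_subset)
      have "(\<Prod>l\<in>B. - of_bool (int l dvd k) :: complex) = (-1) ^ card B * (\<Prod>l\<in>B. of_bool (int l dvd k))"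
        using prod.distrib[of "\<lambda>_. -1" "\<lambda>l. of_bool (int l dvd k) :: complex" B]
        by (simp only: mult_minus1 prod_constant)
      also have "(\<Prod>l\<in>B. of_bool (int l dvd k) :: complex) = of_bool (\<forall>l\<in>B. int l dvd k)"
        using fB by (cases "\<forall>l\<in>B. int l dvd k") (auto intro: prod_zero)
      finally show "of_bool (\<forall>l\<in>\<P> - A. int l dvd k) * (\<Prod>l\<in>B. - of_bool (int l dvd k) :: complex) =
          (-1) ^ card B * of_bool (int (\<Prod>((\<P> - A) \<union> B)) dvd k)"
        using A B by (subst prod_dvd_iff) auto
    qed
    finally show ?thesis .
  qed
  have "(\<Sum>k | k \<in> ?K \<and> supp k = A. ?F k) = (\<Sum>k\<in>?K. if supp k = A then ?F k else 0)"
    by (subst sum.inter_filter) simp_all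
  also have "\<dots> = (\<Sum>k\<in>?K. of_bool (supp k = A) * ?F k)" by (intro sum.cong) auto
  also have "\<dots> = (\<Sum>k\<in>?K. \<Sum>B\<in>Pow A. (-1) ^ card B * (of_bool (int (\<Prod>((\<P> - A) \<union> B)) dvd k) * ?F k))"
    by (simp only: ind sum_distrib_right mult.assoc)
  also have "\<dots> = (\<Sum>B\<in>Pow A. (-1) ^ card B * (\<Sum>k\<in>?K. of_bool (int (\<Prod>((\<P> - A) \<union> B)) dvd k) * ?F k))"
    by (subst sum.swap) (simp only: sum_distrib_left)
  also have "\<dots> = (\<Sum>B\<in>Pow A. (-1) ^ card B * (\<Prod>l\<in>A - B. if int l dvd n then of_nat l else 0))"
  proof (intro sum.cong refl arg_cong2[where f = "(*)"])
    fix B assume B: "B \<in> Pow A"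
    define d where "d = \<Prod>((\<P> - A) \<union> B)"
    define m where "m = \<Prod>(A - B)"
    have sub: "\<P> - A \<union> B \<subseteq> \<P>" "A - B \<subseteq> \<P>" "\<P> - (\<P> - A \<union> B) = A - B" using A B by auto
    have Pdm: "P = d * m" using prod_split[OF sub(1)] unfolding d_def m_def sub(3) .
    have dpos: "d > 0" unfolding d_def using sub(1) by (rule prod_pos_sub)
    have mpos: "m > 0" unfolding m_def using sub(2) by (rule prod_pos_sub)
    have "(\<Sum>k\<in>?K. of_bool (int d dvd k) * ?F k) = (\<Sum>k\<in>?K. if int d dvd k then ?F k else 0)"
      by (intro sum.cong) auto
    also have "\<dots> = (\<Sum>k | k \<in> ?K \<and> int d dvd k. ?F k)"
      by (subst sum.inter_filter) simp_all
    also have "\<dots> = (\<Sum>j<m. ?F (int d * int j))"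
    proof (rule sum.reindex_bij_witness[of _ "\<lambda>j. int d * int j" "\<lambda>k. nat (k div int d)"])
      fix k assume k: "k \<in> {k. k \<in> ?K \<and> int d dvd k}"
      then obtain q where q: "k = int d * q" by auto
      then have "q \<ge> 0" using k dpos by (simp add: zero_le_mult_iff)
      have "int d * q < int d * int m" using k q Pdm by simp
      then have "q < int m" using dpos by simp
      then show "nat (k div int d) \<in> {..<m}" "int d * int (nat (k div int d)) = k"
        using q \<open>q \<ge> 0\<close> dpos by auto
      then show "?F (int d * int (nat (k div int d))) = ?F k" by simp
    next
      fix j assume "j \<in> {..<m}"
      then have "int d * int j < int d * int m" using dpos by simp
      then show "int d * int j \<in> {k. k \<in> ?K \<and> int d dvd k}" using Pdm by simp
      show "nat (int d * int j div int d) = j" using dpos by simp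
    qed
    also have "\<dots> = (\<Sum>j<m. e_circ (of_int n * real j / real m))"
      using dpos by (intro sum.cong refl arg_cong[where f = e_circ]) (simp add: Pdm field_simps)
    also have "\<dots> = (if int m dvd n then of_nat m else 0)" using mpos by (rule sum_e_circ_roots)
    also have "\<dots> = (\<Prod>l\<in>A - B. if int l dvd n then of_nat l else 0)"
    proof (cases "int m dvd n")
      case True
      then have "\<forall>l\<in>A - B. int l dvd n" using prod_dvd_iff[OF sub(2)] by (simp only: m_def)
      then show ?thesis using True by (simp add: m_def)
    next
      case False
      then have "\<exists>l\<in>A - B. \<not> int l dvd n" using prod_dvd_iff[OF sub(2)] by (simp only: m_def) blast
      then have "(\<Prod>l\<in>A - B. if int l dvd n then of_nat l else (0::complex)) = 0"
        using fA by (intro prod_zero) auto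
      then show ?thesis using False by simp
    qed
    finally show "(\<Sum>k\<in>?K. of_bool (int (\<Prod>((\<P> - A) \<union> B)) dvd k) * ?F k) =
        (\<Prod>l\<in>A - B. if int l dvd n then of_nat l else 0)" unfolding d_def .
  qed
  also have "\<dots> = (\<Prod>l\<in>A. - 1 + (if int l dvd n then of_nat l else 0))"
    by (subst prod_add[OF fA]) simp
  finally show ?thesis by simp
qed

lemma sum_support:
  fixes n :: int and \<Phi> :: "nat set \<Rightarrow> complex"
  shows "(\<Sum>k\<in>{0..<int P}. \<Phi> (supp k) * e_circ (of_int n * of_int k / real P)) =
         (\<Sum>A\<in>Pow \<P>. \<Phi> A * (\<Prod>l\<in>A. (if int l dvd n then of_nat l else 0) - 1))"
proof -
  have "(\<Sum>k\<in>{0..<int P}. \<Phi> (supp k) * e_circ (of_int n * of_int k / real P)) =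
     (\<Sum>A\<in>Pow \<P>. \<Sum>k | k \<in> {0..<int P} \<and> supp k = A. \<Phi> (supp k) * e_circ (of_int n * of_int k / real P))"
    by (rule sum.group[symmetric]) (use supp_subset in auto)
  also have "\<dots> = (\<Sum>A\<in>Pow \<P>. \<Phi> A * (\<Sum>k | k \<in> {0..<int P} \<and> supp k = A. e_circ (of_int n * of_int k / real P)))"
    by (simp add: sum_distrib_left)
  also have "\<dots> = (\<Sum>A\<in>Pow \<P>. \<Phi> A * (\<Prod>l\<in>A. (if int l dvd n then of_nat l else 0) - 1))"
    by (intro sum.cong refl arg_cong2[where f = "(*)"] sum_exact_support) simp
  finally show ?thesis .
qed

lemma sum_support_real:
  fixes \<Phi> :: "nat set \<Rightarrow> real"
  shows "(\<Sum>k\<in>{0..<int P}. \<Phi> (supp k)) = (\<Sum>A\<in>Pow \<P>. \<Phi> A * (\<Prod>l\<in>A. real l - 1))"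
proof -
  have "complex_of_real (\<Sum>k\<in>{0..<int P}. \<Phi> (supp k)) = complex_of_real (\<Sum>A\<in>Pow \<P>. \<Phi> A * (\<Prod>l\<in>A. real l - 1))"
    using sum_support[of "\<lambda>A. of_real (\<Phi> A)" 0] by simp
  then show ?thesis by (simp only: of_real_eq_iff)
qed

lemma prod_cancel:
  assumes "A \<subseteq> \<P>"
  shows "(\<Prod>l\<in>A. - 1 / (real l - 1))\<^sup>2 * (\<Prod>l\<in>A. real l - 1) = (\<Prod>l\<in>A. 1 / (real l - 1))"
proof -
  have "(\<Prod>l\<in>A. - 1 / (real l - 1))\<^sup>2 * (\<Prod>l\<in>A. real l - 1) = (\<Prod>l\<in>A. (- 1 / (real l - 1))\<^sup>2 * (real l - 1))"
    by (simp add: prod.distrib prod_power_distrib)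
  also have "\<dots> = (\<Prod>l\<in>A. 1 / (real l - 1))"
    using assms prime_ge2 by (intro prod.cong refl) (force simp: power2_eq_square)
  finally show ?thesis .
qed

text \<open>There are \<open>\<phi>(q)\<close> fractions of denominator \<open>q\<close>, each with squared coefficient \<open>1 / \<phi>(q)\<^sup>2\<close>.\<close>
lemma sum_c_squared: "(\<Sum>k\<in>{0..<int P}. (c k)\<^sup>2) = G"
proof -
  have "(\<Sum>k\<in>{0..<int P}. (c k)\<^sup>2) =
    (\<Sum>k\<in>{0..<int P}. (\<lambda>A. (if real (\<Prod>A) \<le> z then \<Prod>l\<in>A. - 1 / (real l - 1) else 0)\<^sup>2) (supp k))"
    by (simp add: c_def)
  also have "\<dots> = (\<Sum>A\<in>Pow \<P>. (if real (\<Prod>A) \<le> z then \<Prod>l\<in>A. - 1 / (real l - 1) else 0)\<^sup>2 * (\<Prod>l\<in>A. real l - 1))"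
    by (rule sum_support_real)
  also have "\<dots> = (\<Sum>A\<in>Pow \<P>. if real (\<Prod>A) \<le> z then \<Prod>l\<in>A. 1 / (real l - 1) else 0)"
    by (intro sum.cong refl) (use prod_cancel in auto)
  also have "\<dots> = G" unfolding G_def
    by (subst sum.inter_filter[symmetric]) (auto intro!: sum.cong)
  finally show ?thesis .
qed

lemma W_0: "W 0 = G"
  using sum_c_squared by (simp add: W_def power2_eq_square)

lemma G_nonneg: "G \<ge> 0"
  unfolding sum_c_squared[symmetric] by (rule sum_nonneg) simp

lemma sum_c_squared_not_dvd:
  assumes l: "l \<in> \<P>"
  shows "(\<Sum>k\<in>{0..<int P}. if int l dvd k then 0 else (c k)\<^sup>2) \<le> G / (real l - 1)"
proof -
  let ?g = "\<lambda>A. \<Prod>l\<in>A. 1 / (real l - 1)"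
  have g0: "?g A \<ge> 0" if "A \<subseteq> \<P>" for A using that prime_ge2 by (intro prod_nonneg) force
  have l1: "real l - 1 > 0" using prime_ge2[OF l] by simp
  have "(\<Sum>k\<in>{0..<int P}. if int l dvd k then 0 else (c k)\<^sup>2) =
    (\<Sum>k\<in>{0..<int P}. (\<lambda>A. if l \<in> A then (if real (\<Prod>A) \<le> z then \<Prod>l\<in>A. - 1 / (real l - 1) else 0)\<^sup>2 else 0) (supp k))"
    using l by (intro sum.cong refl) (simp add: c_def supp_def)
  also have "\<dots> = (\<Sum>A\<in>Pow \<P>. (if l \<in> A then (if real (\<Prod>A) \<le> z then \<Prod>l\<in>A. - 1 / (real l - 1) else 0)\<^sup>2 else 0) * (\<Prod>l\<in>A. real l - 1))"
    by (rule sum_support_real)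
  also have "\<dots> = (\<Sum>A\<in>Pow \<P>. if l \<in> A \<and> real (\<Prod>A) \<le> z then ?g A else 0)"
    by (intro sum.cong refl) (use prod_cancel in auto)
  also have "\<dots> = (\<Sum>A | A \<in> Pow \<P> \<and> (l \<in> A \<and> real (\<Prod>A) \<le> z). ?g A)"
    by (subst sum.inter_filter[symmetric]) auto
  also have "\<dots> = (\<Sum>A | A \<in> Pow \<P> \<and> (l \<in> A \<and> real (\<Prod>A) \<le> z). 1 / (real l - 1) * ?g (A - {l}))"
    by (intro sum.cong refl prod.remove) (auto intro: finite_sub)
  also have "\<dots> = 1 / (real l - 1) * (\<Sum>A | A \<in> Pow \<P> \<and> (l \<in> A \<and> real (\<Prod>A) \<le> z). ?g (A - {l}))"
    by (rule sum_distrib_left[symmetric])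
  also have "(\<Sum>A | A \<in> Pow \<P> \<and> (l \<in> A \<and> real (\<Prod>A) \<le> z). ?g (A - {l})) =
      (\<Sum>A\<in>(\<lambda>A. A - {l}) ` {A. A \<in> Pow \<P> \<and> (l \<in> A \<and> real (\<Prod>A) \<le> z)}. ?g A)"
    by (subst sum.reindex) (auto intro!: inj_onI)
  also have "\<dots> \<le> G" unfolding G_def
  proof (rule sum_mono2)
    show "finite {A. A \<subseteq> \<P> \<and> real (\<Prod>A) \<le> z}" by (rule finite_subset[of _ "Pow \<P>"]) auto
    show "(\<lambda>A. A - {l}) ` {A. A \<in> Pow \<P> \<and> (l \<in> A \<and> real (\<Prod>A) \<le> z)} \<subseteq> {A. A \<subseteq> \<P> \<and> real (\<Prod>A) \<le> z}"
    proof (rule image_subsetI)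
      fix A assume A: "A \<in> {A. A \<in> Pow \<P> \<and> (l \<in> A \<and> real (\<Prod>A) \<le> z)}"
      have "\<Prod>(A - {l}) dvd \<Prod>A" using A by (intro prod_dvd_prod_subset finite_sub) auto
      then have "\<Prod>(A - {l}) \<le> \<Prod>A" using A prod_pos_sub[of A] by (intro dvd_imp_le) auto
      then have "real (\<Prod>(A - {l})) \<le> real (\<Prod>A)" by (simp only: of_nat_le_iff)
      also have "\<dots> \<le> z" using A by simp
      finally show "A - {l} \<in> {A. A \<subseteq> \<P> \<and> real (\<Prod>A) \<le> z}" using A by auto
    qed
  qed (use g0 in auto)
  finally show ?thesis using l1 by (simp add: divide_right_mono)
qed

text \<open>For \<open>n\<close> coprime to \<open>q\<close> the Ramanujan sum is \<open>\<mu>(q)\<close>, and \<open>\<mu>(q)\<^sup>2 = 1\<close>: this makes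
  \<open>|\<nu>|\<^sup>2 / G\<^sup>2\<close> a majorant of the indicator function of the integers without
  prime factors in the sifting set.\<close>
lemma \<nu>_coprime:
  assumes "\<And>l. l \<in> \<P> \<Longrightarrow> \<not> int l dvd n"
  shows "\<nu> n = of_real G"
proof -
  have "\<nu> n = (\<Sum>k\<in>{0..<int P}. (\<lambda>A. of_real (if real (\<Prod>A) \<le> z then \<Prod>l\<in>A. - 1 / (real l - 1) else 0)) (supp k)
      * e_circ (of_int n * of_int k / real P))"
    unfolding \<nu>_def c_def ..
  also have "\<dots> = (\<Sum>A\<in>Pow \<P>. of_real (if real (\<Prod>A) \<le> z then \<Prod>l\<in>A. - 1 / (real l - 1) else 0)
      * (\<Prod>l\<in>A. (if int l dvd n then of_nat l else 0) - 1))"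
    by (rule sum_support)
  also have "\<dots> = (\<Sum>A\<in>Pow \<P>. of_real (if real (\<Prod>A) \<le> z then \<Prod>l\<in>A. 1 / (real l - 1) else 0))"
  proof (intro sum.cong refl)
    fix A assume A: "A \<in> Pow \<P>"
    have "(\<Prod>l\<in>A. (if int l dvd n then of_nat l else 0) - 1) = (\<Prod>l\<in>A. - 1 :: complex)"
      using assms A by (intro prod.cong) auto
    moreover have "(\<Prod>l\<in>A. - 1 / (real l - 1)) * (\<Prod>l\<in>A. - 1) = (\<Prod>l\<in>A. 1 / (real l - 1))"
      unfolding prod.distrib[symmetric] by (intro prod.cong) simp_all
    then have "complex_of_real (\<Prod>l\<in>A. - 1 / (real l - 1)) * complex_of_real (\<Prod>l\<in>A. - 1) = complex_of_real (\<Prod>l\<in>A. 1 / (real l - 1))"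
      by (simp only: of_real_mult[symmetric])
    then have "complex_of_real (\<Prod>l\<in>A. - 1 / (real l - 1)) * (\<Prod>l\<in>A. - 1) = complex_of_real (\<Prod>l\<in>A. 1 / (real l - 1))"
      by simp
    ultimately show "of_real (if real (\<Prod>A) \<le> z then \<Prod>l\<in>A. - 1 / (real l - 1) else 0)
      * (\<Prod>l\<in>A. (if int l dvd n then of_nat l else 0) - 1) =
      complex_of_real (if real (\<Prod>A) \<le> z then \<Prod>l\<in>A. 1 / (real l - 1) else 0)" by (simp del: prod_constant)
  qed
  also have "\<dots> = of_real (\<Sum>A\<in>Pow \<P>. if real (\<Prod>A) \<le> z then \<Prod>l\<in>A. 1 / (real l - 1) else 0)"
    by (rule of_real_sum[symmetric])
  also have "(\<Sum>A\<in>Pow \<P>. if real (\<Prod>A) \<le> z then \<Prod>l\<in>A. 1 / (real l - 1) else 0) = G" unfolding G_def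
    by (subst sum.inter_filter[symmetric]) (auto intro!: sum.cong)
  finally show ?thesis .
qed

lemma e_circ_mod_P: "e_circ (of_int n * of_int (k mod int P) / real P) = e_circ (of_int n * of_int k / real P)"
proof -
  have "of_int k = real P * of_int (k div int P) + of_int (k mod int P)"
    by (metis mult_div_mod_eq of_int_add of_int_mult of_int_of_nat_eq)
  then have "of_int n * of_int k / real P = of_int n * of_int (k mod int P) / real P + of_int (n * (k div int P))"
    using P_pos by (simp add: field_simps)
  then show ?thesis by (simp only: e_circ_add_int)
qed

lemma \<nu>_squared:
  "of_real ((cmod (\<nu> n))\<^sup>2) = (\<Sum>y\<in>{0..<int P}. of_real (W y) * e_circ (of_int n * of_int y / real P))"
proof -
  let ?K = "{0..<int P}"
  let ?E = "\<lambda>k. e_circ (of_int n * of_int k / real P)"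
  have E_add: "?E (k + y) = ?E k * ?E y" for k y
    by (simp flip: e_circ_add add: add_divide_distrib distrib_left)
  have E1: "?E k * cnj (?E k) = 1" for k by (simp flip: complex_norm_square)
  have "of_real ((cmod (\<nu> n))\<^sup>2) = \<nu> n * cnj (\<nu> n)" by (rule complex_norm_square)
  also have "\<dots> = \<nu> n * (\<Sum>k\<in>?K. of_real (c k) * cnj (?E k))" by (simp add: \<nu>_def)
  also have "\<dots> = (\<Sum>k\<in>?K. of_real (c k) * cnj (?E k) * \<nu> n)" by (simp add: sum_distrib_left mult.commute)
  also have "\<dots> = (\<Sum>k\<in>?K. of_real (c k) * cnj (?E k) * (\<Sum>y\<in>?K. of_real (c (k + y)) * ?E (k + y)))"
  proof (intro sum.cong refl arg_cong2[where f = "(*)"])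
    fix k
    have "(\<Sum>y\<in>?K. (\<lambda>y. of_real (c y) * ?E y) (y + k)) = (\<Sum>y\<in>?K. of_real (c y) * ?E y)"
      by (rule sum_periodic_shift) (use P_pos in \<open>simp_all add: e_circ_mod_P\<close>)
    then show "\<nu> n = (\<Sum>y\<in>?K. of_real (c (k + y)) * ?E (k + y))" by (simp only: \<nu>_def add.commute)
  qed
  also have "\<dots> = (\<Sum>k\<in>?K. \<Sum>y\<in>?K. of_real (c k * c (k + y)) * ?E y)"
  proof (intro sum.cong refl)
    fix k assume "k \<in> ?K"
    show "of_real (c k) * cnj (?E k) * (\<Sum>y\<in>?K. of_real (c (k + y)) * ?E (k + y)) = (\<Sum>y\<in>?K. of_real (c k * c (k + y)) * ?E y)"
      unfolding sum_distrib_left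
    proof (intro sum.cong refl)
      fix y
      have "of_real (c k) * cnj (?E k) * (of_real (c (k + y)) * ?E (k + y)) =
        of_real (c k * c (k + y)) * (?E k * cnj (?E k)) * ?E y" by (simp only: E_add of_real_mult mult_ac)
      then show "of_real (c k) * cnj (?E k) * (of_real (c (k + y)) * ?E (k + y)) = of_real (c k * c (k + y)) * ?E y"
        by (simp only: E1 mult_1_right)
    qed
  qed
  also have "\<dots> = (\<Sum>y\<in>?K. of_real (W y) * ?E y)"
    by (subst sum.swap) (simp only: W_def of_real_sum sum_distrib_right)
  finally show ?thesis .
qed

text \<open>One more prime \<open>l\<close> in the denominator multiplies the coefficient by \<open>- 1 / (l - 1)\<close>, or makes it
  vanish if the denominator passes the truncation \<open>z\<close>.\<close>
lemma abs_c_le_of_one_more_prime: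
  assumes l: "l \<in> \<P>" and ndvd: "\<not> int l dvd a" "int l dvd b"
    and other: "\<And>q. q \<in> \<P> \<Longrightarrow> q \<noteq> l \<Longrightarrow> int q dvd a \<longleftrightarrow> int q dvd b"
  shows "\<bar>c a\<bar> \<le> \<bar>c b\<bar> / (real l - 1)"
proof -
  have sa: "supp a = insert l (supp b)" and lb: "l \<notin> supp b" using assms by (auto simp: supp_def)
  have l1: "real l - 1 > 0" using prime_ge2[OF l] by simp
  show ?thesis
  proof (cases "real (\<Prod>(supp a)) \<le> z")
    case True
    have "\<Prod>(supp b) \<le> l * \<Prod>(supp b)" using prime_ge2[OF l] by simp
    then have "real (\<Prod>(supp b)) \<le> real (\<Prod>(supp a))" unfolding sa using lb by (simp only: prod.insert[OF finite_supp] of_nat_le_iff not_False_eq_True)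
    then have "real (\<Prod>(supp b)) \<le> z" using True by linarith
    moreover have "c a = - 1 / (real l - 1) * (\<Prod>l\<in>supp b. - 1 / (real l - 1))"
      using True lb unfolding c_def sa by simp
    ultimately show ?thesis using l1 by (simp add: c_def abs_mult)
  next
    case False
    then show ?thesis using l1 by (simp add: c_def)
  qed
qed

text \<open>The gain of a factor \<open>l - 1\<close> over the trivial bound \<open>G\<close>.  Since \<open>l\<close> does not divide \<open>y\<close>, it cannot
  divide both \<open>k\<close> and \<open>k + y\<close>.  If it divides exactly one of them, modify the other one at \<open>l\<close> only, so that
  \<open>l\<close> disappears from its denominator; this gains \<open>l - 1\<close>.  If it divides neither, both coefficients
  belong to the part of \<open>\<Sum> c\<^sup>2\<close> with \<open>l\<close> in the denominator, which is at most \<open>G / (l - 1)\<close>.\<close>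
lemma W_le:
  assumes l: "l \<in> \<P>" and y: "\<not> int l dvd y"
  shows "\<bar>W y\<bar> \<le> 3 * G / (real l - 1)"
proof -
  let ?K = "{0..<int P}"
  define t where "t = 1 / (real l - 1)"
  have l1: "real l - 1 > 0" using prime_ge2[OF l] by simp
  then have t0: "t > 0" by (simp add: t_def)
  define q where "q = \<Prod>(\<P> - {l})"
  have "coprime l q" unfolding q_def
    using l prime_P by (intro prod_coprime_right primes_coprime) auto
  then have "coprime (int l) (int q)" by simp
  then obtain u v where uv: "u * int l + v * int q = 1" using bezout_int[of "int l" "int q"] by auto
  \<comment> \<open>\<open>w\<close> is divisible by \<open>l\<close> and congruent to \<open>y\<close> modulo all other primes of the sifting set.\<close>
  define w where "w = y - y * v * int q"
  have "w = y * u * int l" unfolding w_def using uv by (simp add: algebra_simps) (metis distrib_left mult.commute mult.left_commute mult.right_neutral add.commute)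
  then have lw: "int l dvd w" by simp
  have qw: "int r dvd y - w" if "r \<in> \<P>" "r \<noteq> l" for r
  proof -
    have "r dvd q" unfolding q_def using that by (intro dvd_prodI) auto
    then show ?thesis by (simp add: w_def)
  qed
  have shift: "int r dvd x + (y - w) \<longleftrightarrow> int r dvd x" if "r \<in> \<P>" "r \<noteq> l" for r x
    using qw[OF that] by (simp add: dvd_add_left_iff)
  let ?d = "\<lambda>k. if int l dvd k then 0 else (c k)\<^sup>2"
  have amgm: "a * b \<le> (a\<^sup>2 + b\<^sup>2) / 2" for a b :: real
    using sum_squares_bound[of a b] by simp
  have pt: "\<bar>c k\<bar> * \<bar>c (k + y)\<bar> \<le>
      t * (((c k)\<^sup>2 + (c (k + w))\<^sup>2) / 2) + t * (((c (k + (y - w)))\<^sup>2 + (c (k + y))\<^sup>2) / 2) + (?d k + ?d (k + y)) / 2"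
    (is "_ \<le> ?T1 + ?T2 + ?T3") for k
  proof -
    have nn: "?T1 \<ge> 0" "?T2 \<ge> 0" "?T3 \<ge> 0" using t0 by auto
    consider "int l dvd k" | "int l dvd k + y" | "\<not> int l dvd k" "\<not> int l dvd k + y" by blast
    then show ?thesis
    proof cases
      case 1
      have "\<bar>c (k + y)\<bar> \<le> \<bar>c (k + w)\<bar> / (real l - 1)"
      proof (rule abs_c_le_of_one_more_prime[OF l])
        show "\<not> int l dvd k + y" using 1 y by (simp add: dvd_add_right_iff)
        show "int l dvd k + w" using 1 lw by simp
        show "int r dvd k + y \<longleftrightarrow> int r dvd k + w" if "r \<in> \<P>" "r \<noteq> l" for r
          using shift[OF that, of "k + w"] by (simp add: algebra_simps)
      qed
      then have "\<bar>c k\<bar> * \<bar>c (k + y)\<bar> \<le> \<bar>c k\<bar> * (\<bar>c (k + w)\<bar> / (real l - 1))" by (rule mult_left_mono) simp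
      also have "\<dots> = t * (\<bar>c k\<bar> * \<bar>c (k + w)\<bar>)" by (simp add: t_def)
      also have "\<dots> \<le> ?T1" using amgm[of "\<bar>c k\<bar>" "\<bar>c (k + w)\<bar>"] t0 by (intro mult_left_mono) auto
      finally show ?thesis using nn by linarith
    next
      case 2
      have "\<bar>c k\<bar> \<le> \<bar>c (k + (y - w))\<bar> / (real l - 1)"
      proof (rule abs_c_le_of_one_more_prime[OF l])
        show "\<not> int l dvd k" using 2 y by (auto simp: dvd_add_right_iff)
        have "int l dvd (k + y) - w" using 2 lw by (rule dvd_diff)
        then show "int l dvd k + (y - w)" by (simp add: algebra_simps)
        show "int r dvd k \<longleftrightarrow> int r dvd k + (y - w)" if "r \<in> \<P>" "r \<noteq> l" for r
          using shift[OF that] by simp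
      qed
      then have "\<bar>c k\<bar> * \<bar>c (k + y)\<bar> \<le> \<bar>c (k + (y - w))\<bar> / (real l - 1) * \<bar>c (k + y)\<bar>" by (rule mult_right_mono) simp
      also have "\<dots> = t * (\<bar>c (k + (y - w))\<bar> * \<bar>c (k + y)\<bar>)" by (simp add: t_def)
      also have "\<dots> \<le> ?T2" using amgm[of "\<bar>c (k + (y - w))\<bar>" "\<bar>c (k + y)\<bar>"] t0 by (intro mult_left_mono) auto
      finally show ?thesis using nn by linarith
    next
      case 3
      then have "\<bar>c k\<bar> * \<bar>c (k + y)\<bar> \<le> ?T3" using amgm[of "\<bar>c k\<bar>" "\<bar>c (k + y)\<bar>"] by simp
      then show ?thesis using nn by linarith
    qed
  qed
  have S1: "(\<Sum>k\<in>?K. (c (k + x))\<^sup>2) = G" for x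
    unfolding sum_c_squared[symmetric]
    by (rule sum_periodic_shift[of _ "\<lambda>k. (c k)\<^sup>2"]) (use P_pos in simp_all)
  have S2: "(\<Sum>k\<in>?K. ?d (k + x)) \<le> t * G" for x
  proof -
    have "(\<Sum>k\<in>?K. ?d (k + x)) = (\<Sum>k\<in>?K. ?d k)"
      by (rule sum_periodic_shift[of _ ?d]) (use P_pos dvd_P[OF l] in \<open>simp_all add: dvd_mod_iff\<close>)
    also have "\<dots> \<le> t * G" using sum_c_squared_not_dvd[OF l] by (simp add: t_def)
    finally show ?thesis .
  qed
  have "\<bar>W y\<bar> \<le> (\<Sum>k\<in>?K. \<bar>c k * c (k + y)\<bar>)" unfolding W_def by (rule sum_abs)
  also have "\<dots> \<le> (\<Sum>k\<in>?K. t * (((c k)\<^sup>2 + (c (k + w))\<^sup>2) / 2) + t * (((c (k + (y - w)))\<^sup>2 + (c (k + y))\<^sup>2) / 2)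
       + (?d k + ?d (k + y)) / 2)"
    unfolding abs_mult by (rule sum_mono) (rule pt)
  also have "\<dots> = t * (((\<Sum>k\<in>?K. (c k)\<^sup>2) + (\<Sum>k\<in>?K. (c (k + w))\<^sup>2)) / 2)
      + t * (((\<Sum>k\<in>?K. (c (k + (y - w)))\<^sup>2) + (\<Sum>k\<in>?K. (c (k + y))\<^sup>2)) / 2)
      + ((\<Sum>k\<in>?K. ?d k) + (\<Sum>k\<in>?K. ?d (k + y))) / 2"
    by (simp only: sum.distrib sum_distrib_left[symmetric] sum_divide_distrib[symmetric])
  also have "\<dots> \<le> t * G + t * G + t * G"
  proof -
    have "(\<Sum>k\<in>?K. ?d k) \<le> t * G" using S2[of 0] by (simp only: add_0_right)
    moreover have "(a + b) / 2 \<le> e" if "a \<le> e" "b \<le> e" for a b e :: real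
      using add_mono[OF that] by simp
    ultimately have "((\<Sum>k\<in>?K. ?d k) + (\<Sum>k\<in>?K. ?d (k + y))) / 2 \<le> t * G" using S2[of y] by blast
    then show ?thesis by (simp add: S1 sum_c_squared)
  qed
  finally show ?thesis by (simp add: t_def)
qed

lemma W_bound:
  assumes Z: "Z > 0" "\<And>l. l \<in> \<P> \<Longrightarrow> real l - 1 \<ge> Z" and y: "y \<in> {0<..<int P}"
  shows "\<bar>W y\<bar> \<le> 3 * G / Z"
proof -
  have "\<not> int P dvd y" using y zdvd_not_zless[of y "int P"] by auto
  then obtain l where l: "l \<in> \<P>" "\<not> int l dvd y" using prod_dvd_iff[of \<P> y] unfolding P_def by blast
  have "\<bar>W y\<bar> \<le> 3 * G / (real l - 1)" by (rule W_le[OF l])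
  also have "\<dots> \<le> 3 * G / Z" using Z Z(2)[OF l(1)] G_nonneg by (intro divide_left_mono) auto
  finally show ?thesis .
qed

lemma W_nonzero_imp:
  assumes "W y \<noteq> 0" "z \<ge> 0"
  shows "real (\<Prod>(supp y)) \<le> z\<^sup>2"
proof -
  obtain k where "c k * c (k + y) \<noteq> 0"
    using assms(1) unfolding W_def by (rule sum.not_neutral_contains_not_neutral)
  then have k: "real (\<Prod>(supp k)) \<le> z" "real (\<Prod>(supp (k + y))) \<le> z" by (auto simp: c_def split: if_splits)
  have sub: "supp y \<subseteq> supp k \<union> supp (k + y)" by (auto simp: supp_def dvd_add_right_iff)
  have pos: "\<Prod>(supp k) > 0" "\<Prod>(supp (k+y)) > 0" by (rule prod_pos_sub[OF supp_subset])+
  have "\<Prod>(supp y) dvd \<Prod>(supp k \<union> supp (k + y))" using sub by (intro prod_dvd_prod_subset) auto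
  also have "\<Prod>(supp k \<union> supp (k + y)) dvd \<Prod>(supp k) * \<Prod>(supp (k + y))"
    by (simp add: prod.union_inter[OF finite_supp finite_supp, symmetric])
  finally have "\<Prod>(supp y) \<le> \<Prod>(supp k) * \<Prod>(supp (k + y))" using pos by (intro dvd_imp_le) auto
  then have "real (\<Prod>(supp y)) \<le> real (\<Prod>(supp k)) * real (\<Prod>(supp (k + y)))" by (simp only: of_nat_le_iff of_nat_mult[symmetric])
  also have "\<dots> \<le> z * z" using k assms by (intro mult_mono) (auto intro: prod_nonneg)
  finally show ?thesis by (simp add: power2_eq_square)
qed

lemma fraction_supp: "\<exists>a::int. of_int y / real P = of_int a / real (\<Prod>(supp y))"
proof -
  have "\<forall>l\<in>\<P> - supp y. int l dvd y" by (auto simp: supp_def)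
  then have "int (\<Prod>(\<P> - supp y)) dvd y" by (subst prod_dvd_iff) auto
  then obtain a where a: "y = int (\<Prod>(\<P> - supp y)) * a" by (rule dvdE)
  define d where "d = \<Prod>(supp y)"
  define m where "m = \<Prod>(\<P> - supp y)"
  have pos: "m > 0" unfolding m_def by (rule prod_pos_sub) blast
  have "of_int y / real P = (of_int a * real m) / (real d * real m)"
    using prod_split[OF supp_subset[of y]] a unfolding d_def[symmetric] m_def[symmetric] by simp
  also have "\<dots> = of_int a / real (\<Prod>(supp y))"
    using pos unfolding d_def[symmetric] by simp
  finally show ?thesis by blast
qed

text \<open>The difference of two fractions of denominators at most \<open>D\<close> is a fraction of denominator at most
  \<open>D\<^sup>2\<close>, and it is not an integer because the residues modulo \<open>P\<close> are distinct.\<close>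
lemma fractions_spaced:
  assumes y: "y1 \<in> {0..<int P}" "y2 \<in> {0..<int P}" "y1 \<noteq> y2"
    and D: "real (\<Prod>(supp y1)) \<le> D" "real (\<Prod>(supp y2)) \<le> D"
  shows "\<bar>of_int y1 / real P - of_int y2 / real P - of_int n\<bar> \<ge> 1 / D\<^sup>2"
proof -
  define d1 where "d1 = \<Prod>(supp y1)"
  define d2 where "d2 = \<Prod>(supp y2)"
  have pos: "d1 > 0" "d2 > 0" unfolding d1_def d2_def by (rule prod_pos_sub[OF supp_subset])+
  obtain a1 a2 :: int where a: "of_int y1 / real P = of_int a1 / real d1" "of_int y2 / real P = of_int a2 / real d2"
    using fraction_supp[of y1] fraction_supp[of y2] unfolding d1_def d2_def by blast
  define b where "b = a1 * int d2 - a2 * int d1 - n * int d1 * int d2"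
  have eq: "of_int y1 / real P - of_int y2 / real P - of_int n = of_int b / (real d1 * real d2)"
    unfolding a b_def using pos by (simp add: field_simps)
  have "b \<noteq> 0"
  proof
    assume "b = 0"
    then have "of_int y1 / real P - of_int y2 / real P - of_int n = 0" using eq by simp
    then have "of_int y1 - of_int y2 = of_int n * real P" using P_pos by (simp add: field_simps)
    then have "real_of_int (y1 - y2) = real_of_int (n * int P)" by simp
    then have "y1 - y2 = n * int P" by (simp only: of_int_eq_iff)
    then have "int P dvd y1 - y2" by simp
    moreover have "\<bar>y1 - y2\<bar> < int P" using y by auto
    moreover have "y1 - y2 \<noteq> 0" using y(3) by simp
    ultimately show False using dvd_imp_le_int[of "y1 - y2" "int P"] by simp
  qed
  then have "1 \<le> \<bar>b\<bar>" by simp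
  then have b1: "1 \<le> \<bar>real_of_int b\<bar>" by linarith
  have "real d1 \<le> D" "real d2 \<le> D" using D by (simp_all only: d1_def d2_def)
  then have "real d1 * real d2 \<le> D\<^sup>2" unfolding power2_eq_square using pos
    by (intro mult_mono) auto
  then have "1 / D\<^sup>2 \<le> 1 / (real d1 * real d2)" using pos by (intro frac_le) simp_all
  also have "\<dots> \<le> \<bar>real_of_int b\<bar> / (real d1 * real d2)" using b1 by (intro divide_right_mono) simp_all
  also have "\<dots> = \<bar>of_int y1 / real P - of_int y2 / real P - of_int n\<bar>" unfolding eq by (simp add: abs_divide abs_mult)
  finally show ?thesis .
qed

end

section \<open>The Dirichlet kernel at well-spaced points\<close>

definition dirichlet :: "nat \<Rightarrow> real \<Rightarrow> complex" where
  "dirichlet M x = (\<Sum>j<M. e_circ (real j * x))"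

lemma norm_dirichlet_le: "cmod (dirichlet M x) \<le> real M"
  unfolding dirichlet_def using norm_sum[of "\<lambda>j. e_circ (real j * x)" "{..<M}"] by simp

text \<open>Jordan's inequality, from the concavity of the sine.\<close>
lemma sin_pi_ge:
  assumes "0 \<le> r" "r \<le> 1/2"
  shows "2 * r \<le> sin (pi * r)"
proof -
  have "convex_on {0..pi} (\<lambda>x. - sin x)"
  proof (rule f''_ge0_imp_convex[where f' = "\<lambda>x. - cos x" and f'' = sin])
    show "convex {0..pi}" by simp
  qed (auto intro!: derivative_eq_intros sin_ge_zero)
  then have "- sin ((1 - 2 * r) *\<^sub>R 0 + (2 * r) *\<^sub>R (pi / 2)) \<le> (1 - 2 * r) * - sin 0 + 2 * r * - sin (pi / 2)"
    by (rule convex_onD) (use assms in auto)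
  then show ?thesis by (simp add: mult.commute)
qed

lemma norm_dirichlet_squared_le:
  assumes r: "x = r + of_int n" "\<bar>r\<bar> \<le> 1/2" "r \<noteq> 0"
  shows "(cmod (dirichlet M x))\<^sup>2 \<le> 1 / (4 * r\<^sup>2)"
proof -
  have x: "e_circ (real j * x) = e_circ r ^ j" for j
  proof -
    have "real j * x = real j * r + of_int (int j * n)" by (simp add: r(1) distrib_left)
    then show ?thesis by (simp only: e_circ_add_int e_circ_power)
  qed
  have "e_circ r = exp (\<i> * of_real (2 * pi * r))" by (simp add: e_circ_def mult_ac)
  then have "cmod (e_circ r - 1) = 2 * \<bar>sin (pi * r)\<bar>" by (simp only: dist_exp_i_1) simp
  also have "\<bar>sin (pi * r)\<bar> = sin (pi * \<bar>r\<bar>)"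
    using sin_pi_ge[of "\<bar>r\<bar>"] r(2) by (cases "r \<ge> 0") (auto simp: abs_if)
  finally have ge: "cmod (e_circ r - 1) \<ge> 4 * \<bar>r\<bar>" using sin_pi_ge[of "\<bar>r\<bar>"] r(2) by simp
  have "(e_circ r - 1) * dirichlet M x = e_circ r ^ M - 1"
    unfolding dirichlet_def x by (rule power_diff_1_eq[symmetric])
  then have "cmod (e_circ r - 1) * cmod (dirichlet M x) = cmod (e_circ r ^ M - 1)" by (simp only: norm_mult[symmetric])
  also have "\<dots> \<le> 2" using norm_triangle_ineq4[of "e_circ r ^ M" 1] by (simp add: norm_power)
  finally have "4 * \<bar>r\<bar> * cmod (dirichlet M x) \<le> 2"
    using mult_right_mono[OF ge, of "cmod (dirichlet M x)"] by simp
  then have "cmod (dirichlet M x) \<le> 1 / (2 * \<bar>r\<bar>)" using r(3) by (simp add: field_simps)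
  then have "(cmod (dirichlet M x))\<^sup>2 \<le> (1 / (2 * \<bar>r\<bar>))\<^sup>2" by (intro power_mono) auto
  then show ?thesis by (simp add: power_divide power_mult_distrib)
qed

text \<open>Sort the points by their distance to the nearest integer, in steps of \<open>\<delta>\<close>.  Each step contains at most two points, one on
  either side of an integer, so the bounds \<open>(2m)\<^sup>2\<close> and \<open>1 / (4 r\<^sup>2)\<close> with \<open>r \<ge> k\<delta> \<ge> k / (2m)\<close> give at most
  \<open>2 (4m\<^sup>2 + \<Sum>k. m\<^sup>2 / k\<^sup>2) \<le> 12 m\<^sup>2\<close>.\<close>
lemma sum_dirichlet_spaced:
  fixes x :: "'a \<Rightarrow> real"
  assumes X: "finite X" and m: "m > 0" and \<delta>: "\<delta> > 0" "1 \<le> 2 * real m * \<delta>"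
    and spaced: "\<And>i j n. i \<in> X \<Longrightarrow> j \<in> X \<Longrightarrow> i \<noteq> j \<Longrightarrow> \<bar>x i - x j - of_int n\<bar> \<ge> \<delta>"
  shows "(\<Sum>i\<in>X. (cmod (dirichlet (2 * m) (x i)))\<^sup>2) \<le> 12 * (real m)\<^sup>2"
proof -
  define r where "r i = x i - of_int (round (x i))" for i
  have r: "x i = r i + of_int (round (x i))" "\<bar>r i\<bar> \<le> 1/2" for i
    unfolding r_def using of_int_round_abs_le[of "x i"] by (auto simp: abs_minus_commute)
  define \<kappa> where "\<kappa> i = \<lfloor>r i / \<delta>\<rfloor>" for i
  define \<eta> where "\<eta> k = (if k = 0 then 4 * (real m)\<^sup>2 else (real m)\<^sup>2 / (real k)\<^sup>2)" for k
  have \<kappa>: "of_int (\<kappa> i) * \<delta> \<le> r i" "r i < (of_int (\<kappa> i) + 1) * \<delta>" for i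
    using floor_correct[of "r i / \<delta>"] unfolding \<kappa>_def
    by (simp_all only: pos_le_divide_eq[OF \<delta>(1)] pos_divide_less_eq[OF \<delta>(1)] of_int_add of_int_1)
  have inj: "inj_on \<kappa> X"
  proof (rule inj_onI, rule ccontr)
    fix i j assume ij: "i \<in> X" "j \<in> X" "\<kappa> i = \<kappa> j" "i \<noteq> j"
    have "\<bar>r i - r j\<bar> < \<delta>" using \<kappa>[of i] \<kappa>[of j] ij(3) by (simp add: distrib_right)
    then show False using spaced[OF ij(1,2,4), of "round (x i) - round (x j)"] by (simp add: r_def)
  qed
  have far: "(cmod (dirichlet (2 * m) (x i)))\<^sup>2 \<le> \<eta> k" if "k > 0 \<Longrightarrow> real k * \<delta> \<le> \<bar>r i\<bar>" for i k
  proof (cases "k = 0")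
    case True
    have "(cmod (dirichlet (2 * m) (x i)))\<^sup>2 \<le> (real (2 * m))\<^sup>2"
      by (intro power_mono norm_dirichlet_le) simp
    then show ?thesis using True by (simp add: \<eta>_def power_mult_distrib)
  next
    case False
    have pos: "0 < real k * \<delta>" using False \<delta> by simp
    have le: "real k * \<delta> \<le> \<bar>r i\<bar>" using that False by simp
    have "(cmod (dirichlet (2 * m) (x i)))\<^sup>2 \<le> 1 / (4 * (r i)\<^sup>2)"
      by (rule norm_dirichlet_squared_le[OF r]) (use le pos in auto)
    also have "(real k / (2 * real m))\<^sup>2 \<le> \<bar>r i\<bar>\<^sup>2"
    proof (intro power_mono)
      have "real k * 1 \<le> real k * (2 * real m * \<delta>)" by (intro mult_left_mono \<delta>) simp
      then have "real k / (2 * real m) \<le> real k * \<delta>" using m by (simp add: field_simps)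
      then show "real k / (2 * real m) \<le> \<bar>r i\<bar>" using le by linarith
    qed simp
    then have "1 / (4 * (r i)\<^sup>2) \<le> 1 / (4 * (real k / (2 * real m))\<^sup>2)"
      using False m by (intro frac_le) auto
    also have "\<dots> = \<eta> k" using False by (simp add: \<eta>_def power_divide power_mult_distrib)
    finally show ?thesis by linarith
  qed
  have sum_\<eta>: "(\<Sum>k\<in>Y. \<eta> k) \<le> 6 * (real m)\<^sup>2" if "finite Y" for Y
  proof -
    obtain K where K: "Y \<subseteq> {..K}" using \<open>finite Y\<close> finite_nat_iff_bounded_le by blast
    have "(\<Sum>k\<in>Y. \<eta> k) \<le> (\<Sum>k\<in>{..K}. \<eta> k)" using K by (intro sum_mono2) (auto simp: \<eta>_def)
    also have "{..K} = insert 0 {1..K}" by auto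
    also have "(\<Sum>k\<in>insert 0 {1..K}. \<eta> k) = 4 * (real m)\<^sup>2 + (\<Sum>k=1..K. \<eta> k)" by (subst sum.insert) (auto simp: \<eta>_def)
    also have "(\<Sum>k=1..K. \<eta> k) = (real m)\<^sup>2 * (\<Sum>k=1..K. 1 / (real k)\<^sup>2)"
      unfolding sum_distrib_left by (intro sum.cong) (auto simp: \<eta>_def)
    also have "\<dots> \<le> (real m)\<^sup>2 * 2" by (intro mult_left_mono sum_inverse_squares_le) simp
    finally show ?thesis by simp
  qed
  let ?X1 = "{i \<in> X. \<kappa> i \<ge> 0}" and ?X2 = "{i \<in> X. \<kappa> i < 0}"
  have S1: "(\<Sum>i\<in>?X1. (cmod (dirichlet (2 * m) (x i)))\<^sup>2) \<le> 6 * (real m)\<^sup>2"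
  proof -
    have "(\<Sum>i\<in>?X1. (cmod (dirichlet (2 * m) (x i)))\<^sup>2) \<le> (\<Sum>i\<in>?X1. \<eta> (nat (\<kappa> i)))"
    proof (intro sum_mono far)
      fix i assume "i \<in> ?X1"
      then show "real (nat (\<kappa> i)) * \<delta> \<le> \<bar>r i\<bar>" using \<kappa>(1)[of i] by simp
    qed
    also have "\<dots> = (\<Sum>k\<in>(\<lambda>i. nat (\<kappa> i)) ` ?X1. \<eta> k)"
      by (subst sum.reindex) (use inj in \<open>auto simp: inj_on_def\<close>)
    also have "\<dots> \<le> 6 * (real m)\<^sup>2" by (rule sum_\<eta>) (use X in simp)
    finally show ?thesis .
  qed
  have S2: "(\<Sum>i\<in>?X2. (cmod (dirichlet (2 * m) (x i)))\<^sup>2) \<le> 6 * (real m)\<^sup>2"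
  proof -
    have "(\<Sum>i\<in>?X2. (cmod (dirichlet (2 * m) (x i)))\<^sup>2) \<le> (\<Sum>i\<in>?X2. \<eta> (nat (- 1 - \<kappa> i)))"
    proof (intro sum_mono far)
      fix i assume i: "i \<in> ?X2"
      then have "real (nat (- 1 - \<kappa> i)) = - 1 - of_int (\<kappa> i)" by simp
      then show "real (nat (- 1 - \<kappa> i)) * \<delta> \<le> \<bar>r i\<bar>" using \<kappa>(2)[of i] by (simp add: algebra_simps)
    qed
    also have "\<dots> = (\<Sum>k\<in>(\<lambda>i. nat (- 1 - \<kappa> i)) ` ?X2. \<eta> k)"
      by (subst sum.reindex) (use inj in \<open>auto simp: inj_on_def\<close>)
    also have "\<dots> \<le> 6 * (real m)\<^sup>2" by (rule sum_\<eta>) (use X in simp)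
    finally show ?thesis .
  qed
  have "X = ?X1 \<union> ?X2" by auto
  then have "(\<Sum>i\<in>X. (cmod (dirichlet (2 * m) (x i)))\<^sup>2) =
     (\<Sum>i\<in>?X1. (cmod (dirichlet (2 * m) (x i)))\<^sup>2) + (\<Sum>i\<in>?X2. (cmod (dirichlet (2 * m) (x i)))\<^sup>2)"
    using X by (subst \<open>X = _\<close>, intro sum.union_disjoint) auto
  then show ?thesis using S1 S2 by linarith
qed

section \<open>Fourier coefficients on the circle\<close>

abbreviation \<mu> :: "real measure" where "\<mu> \<equiv> lebesgue_on {0..1}"

lemma finite_measure_\<mu> [simp]: "finite_measure \<mu>"
  by (rule finite_measure_lebesgue_on) auto

lemma space_\<mu> [simp]: "space \<mu> = {0..1}" by (simp add: space_restrict_space)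

lemma integrable_bounded:
  fixes f :: "real \<Rightarrow> 'b::{banach, second_countable_topology}"
  assumes "f \<in> borel_measurable \<mu>" "\<And>\<alpha>. norm (f \<alpha>) \<le> B"
  shows "integrable \<mu> f"
  by (rule finite_measure.integrable_const_bound[OF finite_measure_\<mu> _ assms(1), of B]) (use assms(2) in auto)

lemma continuous_measurable_\<mu>:
  assumes "continuous_on {0..1} f"
  shows "f \<in> borel_measurable \<mu>"
  using assms by (intro continuous_imp_measurable_on_sets_lebesgue) auto

lemma e_circ_continuous [continuous_intros]:
  "continuous_on S f \<Longrightarrow> continuous_on S (\<lambda>x. e_circ (f x))"
  unfolding e_circ_def by (intro continuous_intros)

lemma e_circ_measurable [measurable]: "(\<lambda>\<alpha>. e_circ (r * \<alpha>)) \<in> borel_measurable \<mu>"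
  by (intro continuous_measurable_\<mu> continuous_intros)

lemma measure_\<mu> [simp]: "Sigma_Algebra.measure \<mu> {0..1} = 1"
  by (subst measure_restrict_space) auto

lemma integral_e_circ: "(\<integral>\<alpha>. e_circ (of_int n * \<alpha>) \<partial>\<mu>) = of_bool (n = 0)"
proof (cases "n = 0")
  case True
  then show ?thesis by simp
next
  case False
  define w where "w = 2 * \<i> * complex_of_real pi * of_int n"
  have w0: "w \<noteq> 0" using False by (simp add: w_def)
  have e: "e_circ (of_int n * \<alpha>) = exp (w * of_real \<alpha>)" for \<alpha> by (simp add: e_circ_def w_def mult_ac)
  have "((\<lambda>\<alpha>. exp (w * of_real \<alpha>)) has_integral (exp (w * of_real 1) / w - exp (w * of_real 0) / w)) {0..1}"
  proof (rule fundamental_theorem_of_calculus)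
    fix x :: real
    have "((\<lambda>z. exp (w * z) / w) has_field_derivative exp (w * of_real x)) (at (of_real x))"
      using w0 by (auto intro!: derivative_eq_intros)
    then show "((\<lambda>\<alpha>. exp (w * of_real \<alpha>) / w) has_vector_derivative exp (w * of_real x)) (at x within {0..1})"
      by (rule has_vector_derivative_real_field)
  qed simp
  then have "((\<lambda>\<alpha>. e_circ (of_int n * \<alpha>)) has_integral 0) {0..1}"
    using e_circ_of_int[of n] e[of 1] by (simp add: e)
  moreover have "integrable \<mu> (\<lambda>\<alpha>. e_circ (of_int n * \<alpha>))"
    by (rule integrable_bounded[where B = 1]) auto
  ultimately show ?thesis using False
    by (simp add: lebesgue_integral_eq_integral integral_unique)
qed

lemma parseval:
  fixes a :: "int \<Rightarrow> complex"
  assumes F: "finite F"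
  shows "(\<integral>\<alpha>. (cmod (\<Sum>n\<in>F. a n * e_circ (of_int n * \<alpha>)))\<^sup>2 \<partial>\<mu>) = (\<Sum>n\<in>F. (cmod (a n))\<^sup>2)"
proof -
  let ?S = "\<lambda>\<alpha>. \<Sum>n\<in>F. a n * e_circ (of_int n * \<alpha>)"
  have sq: "complex_of_real ((cmod (?S \<alpha>))\<^sup>2) =
      (\<Sum>n\<in>F. \<Sum>k\<in>F. a n * cnj (a k) * e_circ (of_int (n - k) * \<alpha>))" for \<alpha>
  proof -
    have "complex_of_real ((cmod (?S \<alpha>))\<^sup>2) = ?S \<alpha> * cnj (?S \<alpha>)" by (rule complex_norm_square)
    also have "\<dots> = (\<Sum>n\<in>F. \<Sum>k\<in>F. (a n * e_circ (of_int n * \<alpha>)) * (cnj (a k) * e_circ (- (of_int k * \<alpha>))))"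
      by (simp add: sum_product e_circ_minus)
    also have "\<dots> = (\<Sum>n\<in>F. \<Sum>k\<in>F. a n * cnj (a k) * e_circ (of_int (n - k) * \<alpha>))"
    proof (intro sum.cong refl)
      fix n k
      have "e_circ (of_int (n - k) * \<alpha>) = e_circ (of_int n * \<alpha>) * e_circ (- (of_int k * \<alpha>))"
        by (simp add: algebra_simps flip: e_circ_add)
      then show "(a n * e_circ (of_int n * \<alpha>)) * (cnj (a k) * e_circ (- (of_int k * \<alpha>))) = a n * cnj (a k) * e_circ (of_int (n - k) * \<alpha>)"
        by (simp add: mult_ac)
    qed
    finally show ?thesis .
  qed
  have int: "integrable \<mu> (\<lambda>\<alpha>. w * e_circ (of_int n * \<alpha>))" for w n
    by (rule integrable_bounded[where B = "cmod w"]) (auto simp: norm_mult)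
  have "complex_of_real (\<integral>\<alpha>. (cmod (?S \<alpha>))\<^sup>2 \<partial>\<mu>) = (\<integral>\<alpha>. complex_of_real ((cmod (?S \<alpha>))\<^sup>2) \<partial>\<mu>)"
    by (rule integral_complex_of_real[symmetric])
  also have "\<dots> = (\<integral>\<alpha>. (\<Sum>n\<in>F. \<Sum>k\<in>F. a n * cnj (a k) * e_circ (of_int (n - k) * \<alpha>)) \<partial>\<mu>)" by (simp only: sq)
  also have "\<dots> = (\<Sum>n\<in>F. \<Sum>k\<in>F. a n * cnj (a k) * (\<integral>\<alpha>. e_circ (of_int (n - k) * \<alpha>) \<partial>\<mu>))"
    using int by (subst Bochner_Integration.integral_sum) (auto intro!: Bochner_Integration.integrable_sum simp del: of_int_diff)
  also have "\<dots> = (\<Sum>n\<in>F. \<Sum>k\<in>F. if k = n then a n * cnj (a k) else 0)"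
    unfolding integral_e_circ by (intro sum.cong) auto
  also have "\<dots> = (\<Sum>n\<in>F. a n * cnj (a n))" using F by (simp add: sum.delta)
  also have "\<dots> = complex_of_real (\<Sum>n\<in>F. (cmod (a n))\<^sup>2)" by (simp add: complex_norm_square[symmetric])
  finally show ?thesis by (simp only: of_real_eq_iff)
qed

locale bounded_measurable =
  fixes g :: "real \<Rightarrow> complex" and B :: real
  assumes g_measurable [measurable]: "g \<in> borel_measurable \<mu>" and g_bound: "\<And>\<alpha>. cmod (g \<alpha>) \<le> B"
begin

definition \<gamma> :: "int \<Rightarrow> complex" where "\<gamma> n = (\<integral>\<alpha>. e_circ (of_int n * \<alpha>) * g \<alpha> \<partial>\<mu>)"

lemma B_nonneg: "B \<ge> 0" using g_bound[of 0] norm_ge_zero order_trans by blast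

lemma integrable_cmod [simp]: "integrable \<mu> (\<lambda>\<alpha>. cmod (g \<alpha>))"
  by (rule integrable_bounded[where B = B]) (use g_bound in auto)

lemma integrable_cmod_squared [simp]: "integrable \<mu> (\<lambda>\<alpha>. (cmod (g \<alpha>))\<^sup>2)"
  by (rule integrable_bounded[where B = "B\<^sup>2"]) (use g_bound in \<open>auto intro: power_mono\<close>)

lemma integrable_e_g [simp]: "integrable \<mu> (\<lambda>\<alpha>. e_circ (r * \<alpha>) * g \<alpha>)"
  by (rule integrable_bounded[where B = B]) (use g_bound in \<open>auto simp: norm_mult\<close>)

lemma norm_\<gamma>_le: "cmod (\<gamma> n) \<le> (\<integral>\<alpha>. cmod (g \<alpha>) \<partial>\<mu>)"
  using integral_norm_bound[of \<mu> "\<lambda>\<alpha>. e_circ (of_int n * \<alpha>) * g \<alpha>"] by (simp add: \<gamma>_def norm_mult)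

text \<open>Pairing \<open>g\<close> with \<open>Q = \<Sum>n\<in>F. cnj (\<gamma> n) e(n\<alpha>)\<close> gives \<open>s = \<Sum>n\<in>F. |\<gamma> n|\<^sup>2\<close>, and \<open>\<integral> |Q|\<^sup>2 = s\<close> as well; so
  \<open>2 Re (g Q) \<le> |g|\<^sup>2 + |Q|\<^sup>2\<close> yields \<open>2 s \<le> \<integral> |g|\<^sup>2 + s\<close>.\<close>
lemma bessel:
  assumes F: "finite F"
  shows "(\<Sum>n\<in>F. (cmod (\<gamma> n))\<^sup>2) \<le> (\<integral>\<alpha>. (cmod (g \<alpha>))\<^sup>2 \<partial>\<mu>)"
proof -
  define Q where "Q \<alpha> = (\<Sum>n\<in>F. cnj (\<gamma> n) * e_circ (of_int n * \<alpha>))" for \<alpha>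
  define s where "s = (\<Sum>n\<in>F. (cmod (\<gamma> n))\<^sup>2)"
  have Qm [measurable]: "Q \<in> borel_measurable \<mu>" unfolding Q_def by measurable
  define C where "C = (\<Sum>n\<in>F. cmod (\<gamma> n))"
  have QC: "cmod (Q \<alpha>) \<le> C" for \<alpha>
    unfolding Q_def C_def by (rule order_trans[OF norm_sum]) (simp add: norm_mult)
  have iQ: "integrable \<mu> (\<lambda>\<alpha>. (cmod (Q \<alpha>))\<^sup>2)"
    by (rule integrable_bounded[where B = "C\<^sup>2"]) (use QC in \<open>auto intro: power_mono\<close>)
  have igQ: "integrable \<mu> (\<lambda>\<alpha>. g \<alpha> * Q \<alpha>)"
    by (rule integrable_bounded[where B = "B * C"]) (use g_bound QC B_nonneg in \<open>auto simp: norm_mult intro!: mult_mono\<close>)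
  have "(\<integral>\<alpha>. g \<alpha> * Q \<alpha> \<partial>\<mu>) = (\<integral>\<alpha>. (\<Sum>n\<in>F. cnj (\<gamma> n) * (e_circ (of_int n * \<alpha>) * g \<alpha>)) \<partial>\<mu>)"
    unfolding Q_def by (simp add: sum_distrib_left mult_ac)
  also have "\<dots> = (\<Sum>n\<in>F. cnj (\<gamma> n) * \<gamma> n)"
    by (subst Bochner_Integration.integral_sum) (auto simp: \<gamma>_def)
  also have "\<dots> = of_real s" by (simp add: s_def complex_norm_square mult.commute del: of_real_power)
  finally have "s = Re (\<integral>\<alpha>. g \<alpha> * Q \<alpha> \<partial>\<mu>)" by simp
  also have "\<dots> = (\<integral>\<alpha>. Re (g \<alpha> * Q \<alpha>) \<partial>\<mu>)" by (rule integral_Re[OF igQ, symmetric])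
  also have "\<dots> \<le> (\<integral>\<alpha>. (cmod (g \<alpha>))\<^sup>2 / 2 + (cmod (Q \<alpha>))\<^sup>2 / 2 \<partial>\<mu>)"
  proof (rule integral_mono)
    show "integrable \<mu> (\<lambda>\<alpha>. Re (g \<alpha> * Q \<alpha>))" by (rule integrable_Re[OF igQ])
    show "integrable \<mu> (\<lambda>\<alpha>. (cmod (g \<alpha>))\<^sup>2 / 2 + (cmod (Q \<alpha>))\<^sup>2 / 2)" using iQ by simp
    fix \<alpha>
    have "Re (g \<alpha> * Q \<alpha>) \<le> cmod (g \<alpha>) * cmod (Q \<alpha>)" using complex_Re_le_cmod[of "g \<alpha> * Q \<alpha>"] by (simp add: norm_mult)
    also have "\<dots> \<le> (cmod (g \<alpha>))\<^sup>2 / 2 + (cmod (Q \<alpha>))\<^sup>2 / 2" using sum_squares_bound[of "cmod (g \<alpha>)" "cmod (Q \<alpha>)"] by simp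
    finally show "Re (g \<alpha> * Q \<alpha>) \<le> (cmod (g \<alpha>))\<^sup>2 / 2 + (cmod (Q \<alpha>))\<^sup>2 / 2" .
  qed
  also have "\<dots> = (\<integral>\<alpha>. (cmod (g \<alpha>))\<^sup>2 \<partial>\<mu>) / 2 + (\<integral>\<alpha>. (cmod (Q \<alpha>))\<^sup>2 \<partial>\<mu>) / 2" using iQ by simp
  also have "(\<integral>\<alpha>. (cmod (Q \<alpha>))\<^sup>2 \<partial>\<mu>) = s" unfolding Q_def s_def by (subst parseval[OF F]) simp
  finally show ?thesis unfolding s_def by simp
qed

text \<open>The quadratic form \<open>\<Sum>i. a i |\<gamma> (n i)|\<^sup>2\<close> is \<open>\<integral>\<integral> g(s) cnj (g(t)) K(s - t)\<close> with the kernel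
  \<open>K(\<theta>) = \<Sum>i. a i e(n i \<theta>)\<close>, so a uniform bound for the kernel suffices.\<close>
lemma fourier_multiplier_bound:
  fixes a :: "'i \<Rightarrow> complex" and n :: "'i \<Rightarrow> int"
  assumes I: "finite I" and H: "\<And>\<theta>. cmod (\<Sum>i\<in>I. a i * e_circ (of_int (n i) * \<theta>)) \<le> H"
  shows "cmod (\<Sum>i\<in>I. a i * of_real ((cmod (\<gamma> (n i)))\<^sup>2)) \<le> H * (\<integral>\<alpha>. cmod (g \<alpha>) \<partial>\<mu>)\<^sup>2"
proof -
  let ?L = "\<integral>\<alpha>. cmod (g \<alpha>) \<partial>\<mu>"
  define R where "R s = (\<Sum>i\<in>I. a i * cnj (\<gamma> (n i)) * e_circ (of_int (n i) * s))" for s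
  have L0: "?L \<ge> 0" by simp
  have H0: "H \<ge> 0" using H[of 0] norm_ge_zero order_trans by blast
  have ig: "integrable \<mu> (\<lambda>t. w * cnj (e_circ (of_int k * t) * g t))" for k w
    by (intro integrable_mult_right integrable_cnj integrable_e_g)
  have Rb: "cmod (R s) \<le> H * ?L" for s
  proof -
    have "R s = (\<Sum>i\<in>I. (\<integral>t. (a i * e_circ (of_int (n i) * s)) * cnj (e_circ (of_int (n i) * t) * g t) \<partial>\<mu>))"
    proof -
      have cg: "(\<integral>t. w * cnj (e_circ (of_int k * t) * g t) \<partial>\<mu>) = w * cnj (\<gamma> k)" for w k
        unfolding \<gamma>_def by (subst integral_mult_right_zero, subst Bochner_Integration.integral_cnj, rule refl)
      show ?thesis unfolding R_def cg by (intro sum.cong refl) (simp only: mult_ac)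
    qed
    also have "\<dots> = (\<integral>t. (\<Sum>i\<in>I. (a i * e_circ (of_int (n i) * s)) * cnj (e_circ (of_int (n i) * t) * g t)) \<partial>\<mu>)"
      by (rule Bochner_Integration.integral_sum[symmetric]) (rule ig)
    also have "\<dots> = (\<integral>t. cnj (g t) * (\<Sum>i\<in>I. a i * e_circ (of_int (n i) * (s - t))) \<partial>\<mu>)"
    proof (intro Bochner_Integration.integral_cong refl)
      fix t
      have es: "e_circ (of_int k * (s - t)) = e_circ (of_int k * s) * cnj (e_circ (of_int k * t))" for k
        by (simp add: right_diff_distrib flip: e_circ_minus e_circ_add)
      show "(\<Sum>i\<in>I. (a i * e_circ (of_int (n i) * s)) * cnj (e_circ (of_int (n i) * t) * g t)) =
        cnj (g t) * (\<Sum>i\<in>I. a i * e_circ (of_int (n i) * (s - t)))"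
        unfolding es by (simp add: sum_distrib_left mult_ac)
    qed
    finally have "cmod (R s) \<le> (\<integral>t. cmod (cnj (g t) * (\<Sum>i\<in>I. a i * e_circ (of_int (n i) * (s - t)))) \<partial>\<mu>)"
      by (simp only: integral_norm_bound)
    also have "\<dots> \<le> (\<integral>t. H * cmod (g t) \<partial>\<mu>)"
    proof (rule Bochner_Integration.integral_mono')
      show "integrable \<mu> (\<lambda>t. H * cmod (g t))" by simp
      fix t
      show "cmod (cnj (g t) * (\<Sum>i\<in>I. a i * e_circ (of_int (n i) * (s - t)))) \<le> H * cmod (g t)"
        using mult_right_mono[OF H[of "s - t"], of "cmod (g t)"] by (simp add: norm_mult mult.commute)
    qed (use H0 in simp)
    finally show ?thesis by simp
  qed
  have "(\<Sum>i\<in>I. a i * of_real ((cmod (\<gamma> (n i)))\<^sup>2)) = (\<Sum>i\<in>I. (\<integral>s. (a i * cnj (\<gamma> (n i))) * (e_circ (of_int (n i) * s) * g s) \<partial>\<mu>))"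
  proof (intro sum.cong refl)
    fix i
    have "(\<integral>s. (a i * cnj (\<gamma> (n i))) * (e_circ (of_int (n i) * s) * g s) \<partial>\<mu>) = a i * cnj (\<gamma> (n i)) * \<gamma> (n i)"
      unfolding \<gamma>_def[of "n i"] by (rule integral_mult_right_zero)
    also have "\<dots> = a i * of_real ((cmod (\<gamma> (n i)))\<^sup>2)" unfolding complex_norm_square by (simp only: mult_ac)
    finally show "a i * of_real ((cmod (\<gamma> (n i)))\<^sup>2) = (\<integral>s. (a i * cnj (\<gamma> (n i))) * (e_circ (of_int (n i) * s) * g s) \<partial>\<mu>)" by (rule sym)
  qed
  also have "\<dots> = (\<integral>s. (\<Sum>i\<in>I. (a i * cnj (\<gamma> (n i))) * (e_circ (of_int (n i) * s) * g s)) \<partial>\<mu>)"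
    by (rule Bochner_Integration.integral_sum[symmetric]) simp
  also have "\<dots> = (\<integral>s. g s * R s \<partial>\<mu>)"
    by (intro Bochner_Integration.integral_cong refl) (simp add: R_def sum_distrib_left mult_ac)
  finally have "cmod (\<Sum>i\<in>I. a i * of_real ((cmod (\<gamma> (n i)))\<^sup>2)) \<le> (\<integral>s. cmod (g s * R s) \<partial>\<mu>)"
    by (simp only: integral_norm_bound)
  also have "\<dots> \<le> (\<integral>s. (H * ?L) * cmod (g s) \<partial>\<mu>)"
  proof (rule Bochner_Integration.integral_mono')
    show "integrable \<mu> (\<lambda>s. (H * ?L) * cmod (g s))" by simp
    fix s
    show "cmod (g s * R s) \<le> (H * ?L) * cmod (g s)"
      using mult_right_mono[OF Rb[of s], of "cmod (g s)"] by (simp add: norm_mult mult.commute)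
  qed (use H0 L0 in simp)
  also have "\<dots> = H * ?L\<^sup>2" by (simp add: power2_eq_square)
  finally show ?thesis .
qed

end

section \<open>The dual sieve inequality\<close>

locale dual_sieve = prime_sieve \<P> z + bounded_measurable g B
  for \<P> :: "nat set" and z :: real and g :: "real \<Rightarrow> complex" and B :: real
begin

text \<open>The number of pairs \<open>i, j < 2m\<close> with \<open>m + i - j = p\<close> is \<open>2m - |p - m|\<close>, at least \<open>m\<close> for
  \<open>1 \<le> p \<le> 2m\<close>.  Summing over pairs thus inserts a Fejer weight, whose kernel \<open>|dirichlet|\<^sup>2\<close> is
  nonnegative and well concentrated.\<close>
lemma fejer_weight_ge:
  fixes X :: "int \<Rightarrow> real"
  assumes X: "\<And>n. X n \<ge> 0" and Q: "Q \<subseteq> {1..2 * m}"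
  shows "real m * (\<Sum>p\<in>Q. X (int p)) \<le> (\<Sum>(i, j)\<in>{..<2 * m} \<times> {..<2 * m}. X (int m + int i - int j))"
proof -
  let ?\<phi> = "\<lambda>(p, s). (s + (p - m), s + (m - p))"
  have N: "int m + int (s + (p - m)) - int (s + (m - p)) = int p" for p s by (cases "p \<le> m") auto
  have fQ: "finite Q" using Q by (rule finite_subset) simp
  have inj: "inj_on ?\<phi> (Q \<times> {..<m})"
  proof (rule inj_onI, clarify)
    fix p s p' s'
    assume eq: "s + (p - m) = s' + (p' - m)" "s + (m - p) = s' + (m - p')"
    then have "int p = int p'" using N[of s p] N[of s' p'] by simp
    then show "p = p' \<and> s = s'" using eq by simp
  qed
  have "real m * (\<Sum>p\<in>Q. X (int p)) = (\<Sum>(p, s)\<in>Q \<times> {..<m}. X (int p))"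
    by (subst sum.cartesian_product[symmetric]) (simp add: sum_distrib_left)
  also have "\<dots> = (\<Sum>(i, j)\<in>?\<phi> ` (Q \<times> {..<m}). X (int m + int i - int j))"
    by (subst sum.reindex[OF inj], intro sum.cong refl) (simp add: case_prod_unfold N del: of_nat_add)
  also have "\<dots> \<le> (\<Sum>(i, j)\<in>{..<2 * m} \<times> {..<2 * m}. X (int m + int i - int j))"
  proof (rule sum_mono2)
    show "?\<phi> ` (Q \<times> {..<m}) \<subseteq> {..<2 * m} \<times> {..<2 * m}"
    proof (rule image_subsetI)
      fix q assume "q \<in> Q \<times> {..<m}"
      then obtain p s where q: "q = (p, s)" "p \<in> Q" "s < m" by auto
      then have "p \<le> 2 * m" using Q by auto
      then show "?\<phi> q \<in> {..<2 * m} \<times> {..<2 * m}" using q by auto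
    qed
  qed (use X in auto)
  finally show ?thesis .
qed

lemma fejer_weight_le:
  fixes X :: "int \<Rightarrow> real"
  assumes X: "\<And>n. X n \<ge> 0"
  shows "(\<Sum>(i, j)\<in>{..<2 * m} \<times> {..<2 * m}. X (int m + int i - int j)) \<le> 2 * real m * (\<Sum>n\<in>{- int m..3 * int m}. X n)"
proof -
  have "(\<Sum>(i, j)\<in>{..<2 * m} \<times> {..<2 * m}. X (int m + int i - int j)) = (\<Sum>i<2 * m. \<Sum>j<2 * m. X (int m + int i - int j))"
    by (rule sum.cartesian_product[symmetric])
  also have "\<dots> \<le> (\<Sum>i<2 * m. \<Sum>n\<in>{- int m..3 * int m}. X n)"
  proof (rule sum_mono)
    fix i assume i: "i \<in> {..<2 * m}"
    have "(\<Sum>j<2 * m. X (int m + int i - int j)) = (\<Sum>n\<in>(\<lambda>j. int m + int i - int j) ` {..<2 * m}. X n)"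
      by (subst sum.reindex) (auto intro!: inj_onI)
    also have "\<dots> \<le> (\<Sum>n\<in>{- int m..3 * int m}. X n)"
      using i X by (intro sum_mono2) auto
    finally show "(\<Sum>j<2 * m. X (int m + int i - int j)) \<le> (\<Sum>n\<in>{- int m..3 * int m}. X n)" .
  qed
  finally show ?thesis by simp
qed

lemma fejer_kernel:
  "(\<Sum>(i, j)\<in>{..<M} \<times> {..<M}. e_circ (of_int (int m + int i - int j) * \<phi>)) =
     e_circ (real m * \<phi>) * of_real ((cmod (dirichlet M \<phi>))\<^sup>2)"
proof -
  have e: "e_circ (of_int (int m + int i - int j) * \<phi>) =
      e_circ (real m * \<phi>) * (e_circ (real i * \<phi>) * cnj (e_circ (real j * \<phi>)))" for i j
    by (simp add: algebra_simps flip: e_circ_minus e_circ_add)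
  show ?thesis
    unfolding e complex_norm_square dirichlet_def cnj_sum sum_product sum.cartesian_product
    by (simp only: sum_distrib_left case_prod_unfold)
qed

text \<open>By \<open>\<nu>_coprime\<close> the factor \<open>|\<nu> p|\<^sup>2 = G\<^sup>2\<close> can be inserted on \<open>Q\<close>, and then all integers \<open>m + i - j\<close> may be
  admitted.  Expanding \<open>|\<nu>|\<^sup>2\<close> into its frequencies \<open>y / P\<close>, the frequency \<open>0\<close> is treated by Bessel's inequality
  and the others by \<open>fourier_multiplier_bound\<close>: their coefficients are at most \<open>3 G / Z\<close>, and
  their kernels \<open>|dirichlet (2m) (\<theta> + y / P)|\<^sup>2\<close> add up to at most \<open>12 m\<^sup>2\<close> because they are spaced by
  \<open>z\<^bsup>-4\<^esup> \<ge> 1 / (2m)\<close>.\<close>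
lemma dual_sieve_inequality:
  fixes m :: nat
  assumes z: "z \<ge> 1" "z ^ 4 \<le> 2 * real m"
    and Z: "Z > 0" "\<And>l. l \<in> \<P> \<Longrightarrow> Z \<le> real l - 1"
    and Q: "Q \<subseteq> {1..2 * m}" "\<And>p l. p \<in> Q \<Longrightarrow> l \<in> \<P> \<Longrightarrow> \<not> l dvd p"
  shows "G * (\<Sum>p\<in>Q. (cmod (\<gamma> (int p)))\<^sup>2) \<le>
     2 * (\<integral>\<alpha>. (cmod (g \<alpha>))\<^sup>2 \<partial>\<mu>) + 36 * real m / Z * (\<integral>\<alpha>. cmod (g \<alpha>) \<partial>\<mu>)\<^sup>2"
proof -
  define J where "J = {..<2 * m} \<times> {..<2 * m}"
  define n where "n = (\<lambda>(i, j). int m + int i - int j)"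
  define Y where "Y = {0<..<int P}"
  define L where "L = (\<integral>\<alpha>. cmod (g \<alpha>) \<partial>\<mu>)"
  let ?E = "\<lambda>k y. e_circ (of_int k * of_int y / real P)"
  have finJ: "finite J" by (simp add: J_def)
  have m0: "m > 0"
  proof -
    have "1 \<le> z ^ 4" using z by (intro one_le_power)
    then show ?thesis using z by (cases "m = 0") auto
  qed
  have K: "{0..<int P} = insert 0 Y" using P_pos by (auto simp: Y_def)
  have split: "of_real ((cmod (\<nu> k))\<^sup>2) = of_real G + (\<Sum>y\<in>Y. of_real (W y) * ?E k y)" for k
    unfolding \<nu>_squared K by (subst sum.insert) (auto simp: Y_def W_0)
  define a where "a q = (\<Sum>y\<in>Y. of_real (W y) * ?E (n q) y)" for q
  have "real m * (\<Sum>p\<in>Q. (cmod (\<nu> (int p)))\<^sup>2 * (cmod (\<gamma> (int p)))\<^sup>2) \<le> (\<Sum>q\<in>J. (cmod (\<nu> (n q)))\<^sup>2 * (cmod (\<gamma> (n q)))\<^sup>2)"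
    using fejer_weight_ge[OF _ Q(1), of "\<lambda>k. (cmod (\<nu> k))\<^sup>2 * (cmod (\<gamma> k))\<^sup>2"]
    unfolding J_def n_def by (simp add: case_prod_unfold)
  also have "\<dots> = cmod (of_real (\<Sum>q\<in>J. (cmod (\<nu> (n q)))\<^sup>2 * (cmod (\<gamma> (n q)))\<^sup>2))"
    by (subst norm_of_real) (simp add: sum_nonneg)
  also have "complex_of_real (\<Sum>q\<in>J. (cmod (\<nu> (n q)))\<^sup>2 * (cmod (\<gamma> (n q)))\<^sup>2) =
      (\<Sum>q\<in>J. (of_real G + a q) * of_real ((cmod (\<gamma> (n q)))\<^sup>2))"
    unfolding of_real_sum of_real_mult split a_def ..
  also have "\<dots> = of_real (G * (\<Sum>q\<in>J. (cmod (\<gamma> (n q)))\<^sup>2)) + (\<Sum>q\<in>J. a q * of_real ((cmod (\<gamma> (n q)))\<^sup>2))"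
    by (simp add: distrib_right sum.distrib sum_distrib_left)
  also have "cmod \<dots> \<le> cmod (of_real (G * (\<Sum>q\<in>J. (cmod (\<gamma> (n q)))\<^sup>2))) + cmod (\<Sum>q\<in>J. a q * of_real ((cmod (\<gamma> (n q)))\<^sup>2))"
    by (rule norm_triangle_ineq)
  also have "cmod (of_real (G * (\<Sum>q\<in>J. (cmod (\<gamma> (n q)))\<^sup>2))) = G * (\<Sum>q\<in>J. (cmod (\<gamma> (n q)))\<^sup>2)"
    using G_nonneg by (subst norm_of_real) (simp add: sum_nonneg)
  finally have le: "real m * (\<Sum>p\<in>Q. (cmod (\<nu> (int p)))\<^sup>2 * (cmod (\<gamma> (int p)))\<^sup>2) \<le>
      G * (\<Sum>q\<in>J. (cmod (\<gamma> (n q)))\<^sup>2) + cmod (\<Sum>q\<in>J. a q * of_real ((cmod (\<gamma> (n q)))\<^sup>2))" .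
  have diag: "(\<Sum>q\<in>J. (cmod (\<gamma> (n q)))\<^sup>2) \<le> 2 * real m * (\<integral>\<alpha>. (cmod (g \<alpha>))\<^sup>2 \<partial>\<mu>)"
  proof -
    have "(\<Sum>q\<in>J. (cmod (\<gamma> (n q)))\<^sup>2) \<le> 2 * real m * (\<Sum>k\<in>{- int m..3 * int m}. (cmod (\<gamma> k))\<^sup>2)"
      using fejer_weight_le[of "\<lambda>k. (cmod (\<gamma> k))\<^sup>2" m] unfolding J_def n_def by (simp add: case_prod_unfold)
    also have "\<dots> \<le> 2 * real m * (\<integral>\<alpha>. (cmod (g \<alpha>))\<^sup>2 \<partial>\<mu>)" by (intro mult_left_mono bessel) auto
    finally show ?thesis .
  qed
  have off: "cmod (\<Sum>q\<in>J. a q * of_real ((cmod (\<gamma> (n q)))\<^sup>2)) \<le> (3 * G / Z * (12 * (real m)\<^sup>2)) * L\<^sup>2"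
    unfolding L_def
  proof (rule fourier_multiplier_bound[OF finJ])
    fix \<theta> :: real
    define Y' where "Y' = {y \<in> Y. W y \<noteq> 0}"
    have finY: "finite Y" by (simp add: Y_def)
    have "(\<Sum>q\<in>J. a q * e_circ (of_int (n q) * \<theta>)) =
      (\<Sum>q\<in>J. \<Sum>y\<in>Y. of_real (W y) * e_circ (of_int (n q) * (\<theta> + of_int y / real P)))"
      unfolding a_def sum_distrib_right
    proof (intro sum.cong refl)
      fix q y
      have "?E (n q) y * e_circ (of_int (n q) * \<theta>) = e_circ (of_int (n q) * (\<theta> + of_int y / real P))"
        by (simp add: algebra_simps flip: e_circ_add)
      then show "of_real (W y) * ?E (n q) y * e_circ (of_int (n q) * \<theta>) = of_real (W y) * e_circ (of_int (n q) * (\<theta> + of_int y / real P))"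
        by (simp only: mult.assoc)
    qed
    also have "\<dots> = (\<Sum>y\<in>Y. of_real (W y) * (\<Sum>q\<in>J. e_circ (of_int (n q) * (\<theta> + of_int y / real P))))"
      by (subst sum.swap) (simp only: sum_distrib_left)
    also have "\<dots> = (\<Sum>y\<in>Y'. of_real (W y) * (\<Sum>q\<in>J. e_circ (of_int (n q) * (\<theta> + of_int y / real P))))"
      by (rule sum.mono_neutral_right) (use finY in \<open>auto simp: Y'_def\<close>)
    finally have "cmod (\<Sum>q\<in>J. a q * e_circ (of_int (n q) * \<theta>)) \<le>
        (\<Sum>y\<in>Y'. cmod (of_real (W y) * (\<Sum>q\<in>J. e_circ (of_int (n q) * (\<theta> + of_int y / real P)))))"
      by (simp only: norm_sum)
    also have "\<dots> \<le> (\<Sum>y\<in>Y'. 3 * G / Z * (cmod (dirichlet (2 * m) (\<theta> + of_int y / real P)))\<^sup>2)"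
    proof (rule sum_mono)
      fix y assume y: "y \<in> Y'"
      let ?\<phi> = "\<theta> + of_int y / real P"
      have "(\<Sum>q\<in>J. e_circ (of_int (n q) * ?\<phi>)) = e_circ (real m * ?\<phi>) * of_real ((cmod (dirichlet (2 * m) ?\<phi>))\<^sup>2)"
        using fejer_kernel[where M = "2 * m" and m = m and \<phi> = ?\<phi>] unfolding J_def n_def by (simp only: case_prod_unfold)
      then have "cmod (of_real (W y) * (\<Sum>q\<in>J. e_circ (of_int (n q) * ?\<phi>))) = \<bar>W y\<bar> * (cmod (dirichlet (2 * m) ?\<phi>))\<^sup>2"
        by (simp add: norm_mult norm_power)
      also have "\<dots> \<le> 3 * G / Z * (cmod (dirichlet (2 * m) ?\<phi>))\<^sup>2"
        using y by (intro mult_right_mono W_bound Z) (auto simp: Y'_def Y_def)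
      finally show "cmod (of_real (W y) * (\<Sum>q\<in>J. e_circ (of_int (n q) * ?\<phi>))) \<le> 3 * G / Z * (cmod (dirichlet (2 * m) ?\<phi>))\<^sup>2" .
    qed
    also have "\<dots> = 3 * G / Z * (\<Sum>y\<in>Y'. (cmod (dirichlet (2 * m) (\<theta> + of_int y / real P)))\<^sup>2)"
      by (rule sum_distrib_left[symmetric])
    also have "\<dots> \<le> 3 * G / Z * (12 * (real m)\<^sup>2)"
    proof (intro mult_left_mono sum_dirichlet_spaced)
      show "1 / (z\<^sup>2)\<^sup>2 > 0" using z by simp
      have "(z\<^sup>2)\<^sup>2 = z ^ 4" by (simp flip: power_mult)
      then show "1 \<le> 2 * real m * (1 / (z\<^sup>2)\<^sup>2)" using z by (simp add: field_simps)
      show "finite Y'" using finY by (simp add: Y'_def)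
      show "0 \<le> 3 * G / Z" using G_nonneg Z by simp
      fix y1 y2 k assume y: "y1 \<in> Y'" "y2 \<in> Y'" "y1 \<noteq> y2"
      have "1 / (z\<^sup>2)\<^sup>2 \<le> \<bar>of_int y1 / real P - of_int y2 / real P - of_int k\<bar>"
        using y z by (intro fractions_spaced W_nonzero_imp) (auto simp: Y'_def Y_def)
      then show "1 / (z\<^sup>2)\<^sup>2 \<le> \<bar>\<theta> + of_int y1 / real P - (\<theta> + of_int y2 / real P) - of_int k\<bar>" by simp
    qed (use m0 in simp)
    finally show "cmod (\<Sum>q\<in>J. a q * e_circ (of_int (n q) * \<theta>)) \<le> 3 * G / Z * (12 * (real m)\<^sup>2)" .
  qed
  have "real m * (\<Sum>p\<in>Q. (cmod (\<nu> (int p)))\<^sup>2 * (cmod (\<gamma> (int p)))\<^sup>2) = real m * G * (G * (\<Sum>p\<in>Q. (cmod (\<gamma> (int p)))\<^sup>2))"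
  proof -
    have "(\<Sum>p\<in>Q. (cmod (\<nu> (int p)))\<^sup>2 * (cmod (\<gamma> (int p)))\<^sup>2) = (\<Sum>p\<in>Q. G\<^sup>2 * (cmod (\<gamma> (int p)))\<^sup>2)"
      using Q(2) G_nonneg by (intro sum.cong refl) (simp add: \<nu>_coprime)
    then show ?thesis by (simp add: sum_distrib_left[symmetric] power2_eq_square)
  qed
  then have "real m * G * (G * (\<Sum>p\<in>Q. (cmod (\<gamma> (int p)))\<^sup>2)) \<le>
      G * (2 * real m * (\<integral>\<alpha>. (cmod (g \<alpha>))\<^sup>2 \<partial>\<mu>)) + 3 * G / Z * (12 * (real m)\<^sup>2) * L\<^sup>2"
    using le off mult_left_mono[OF diag G_nonneg] by linarith
  then have *: "real m * G * (G * (\<Sum>p\<in>Q. (cmod (\<gamma> (int p)))\<^sup>2)) \<le>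
     real m * G * (2 * (\<integral>\<alpha>. (cmod (g \<alpha>))\<^sup>2 \<partial>\<mu>) + 36 * real m / Z * L\<^sup>2)"
    by (simp add: algebra_simps power2_eq_square)
  show ?thesis
  proof (cases "G = 0")
    case True
    then show ?thesis using Z by simp
  next
    case False
    then have "real m * G > 0" using m0 G_nonneg by simp
    then show ?thesis using * unfolding L_def by (simp only: mult_le_cancel_left_pos)
  qed
qed

end

section \<open>The restriction estimate\<close>

text \<open>Let \<open>T\<close> be the left-hand side and \<open>g = 1\<^sub>E cnj S\<close>.  Then \<open>T = \<integral> |g|\<^sup>2 = \<Sum>p. u p \<gamma> p\<close>, so \<open>T\<^sup>2\<close> is at most
  \<open>(\<Sum> |u p|\<^sup>2) (\<Sum> |\<gamma> p|\<^sup>2)\<close>, and it remains to bound the last sum by a multiple of \<open>T\<close>.  Primes above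
  \<open>z = N\<^bsup>1/4\<^esup>\<close> are handled by \<open>dual_sieve_inequality\<close>, the few others by \<open>|\<gamma> p| \<le> \<integral> |g|\<close>.\<close>
lemma restriction_estimate:
  fixes N :: real and u :: "nat \<Rightarrow> complex" and E :: "real set"
  defines "S \<equiv> \<lambda>\<alpha>. \<Sum>p\<in>primes_upto N. u p * e_circ (real p * \<alpha>)"
    and "\<tau> \<equiv> Sigma_Algebra.measure \<mu> E"
  assumes N: "N > 1" and E: "E \<in> sets \<mu>"
  shows "(\<integral>\<alpha>. indicator E \<alpha> * (cmod (S \<alpha>))\<^sup>2 \<partial>\<mu>) \<le>
    (64 * (1 + 2 * ln (36 * (N * \<tau>) + 80)) / ln N + N powr (1/4) * \<tau>) * (\<Sum>p\<in>primes_upto N. (cmod (u p))\<^sup>2)"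
proof -
  define z where "z = N powr (1/4)"
  define m where "m = nat \<lceil>N / 2\<rceil>"
  \<comment> \<open>\<open>Z \<ge> 18 m \<tau>\<close> balances the two terms of the dual inequality; adding 1 keeps \<open>Z\<close> positive.\<close>
  define Z where "Z = nat \<lceil>18 * real m * \<tau>\<rceil> + 1"
  define \<P> where "\<P> = {p \<in> primes_upto z. Z < p}"
  define U where "U = (\<Sum>p\<in>primes_upto N. (cmod (u p))\<^sup>2)"
  define g where "g \<alpha> = indicator E \<alpha> * cnj (S \<alpha>)" for \<alpha>
  define C where "C = (\<Sum>p\<in>primes_upto N. cmod (u p))"
  have E' [measurable]: "E \<in> sets \<mu>" by (rule E)
  have Sm [measurable]: "S \<in> borel_measurable \<mu>" unfolding S_def by measurable
  have SC: "cmod (S \<alpha>) \<le> C" for \<alpha>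
    unfolding S_def C_def by (rule order_trans[OF norm_sum]) (simp add: norm_mult)
  have C0: "C \<ge> 0" by (simp add: C_def sum_nonneg)
  have \<tau>: "0 \<le> \<tau>" "\<tau> \<le> 1"
  proof -
    show "0 \<le> \<tau>" by (simp add: \<tau>_def)
    have "\<tau> \<le> Sigma_Algebra.measure \<mu> (space \<mu>)" unfolding \<tau>_def
      by (rule finite_measure.bounded_measure[OF finite_measure_\<mu>])
    then show "\<tau> \<le> 1" by simp
  qed
  have cnjS [measurable]: "(\<lambda>\<alpha>. cnj (S \<alpha>)) \<in> borel_measurable \<mu>"
    by (intro borel_measurable_integrable integrable_cnj integrable_bounded[OF Sm SC])
  have cmod_g: "cmod (g \<alpha>) = indicator E \<alpha> * cmod (S \<alpha>)" for \<alpha> by (simp add: g_def norm_mult indicator_def)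
  interpret dual_sieve \<P> z g C
  proof
    show "finite \<P>" by (simp add: \<P>_def)
    show "prime l" if "l \<in> \<P>" for l using that by (simp add: \<P>_def primes_upto_def)
    show "g \<in> borel_measurable \<mu>" unfolding g_def by measurable
    show "cmod (g \<alpha>) \<le> C" for \<alpha> using SC[of \<alpha>] C0 by (simp add: cmod_g indicator_def)
  qed
  define T where "T = (\<integral>\<alpha>. (cmod (g \<alpha>))\<^sup>2 \<partial>\<mu>)"
  define L where "L = (\<integral>\<alpha>. cmod (g \<alpha>) \<partial>\<mu>)"
  have T_eq: "T = (\<integral>\<alpha>. indicator E \<alpha> * (cmod (S \<alpha>))\<^sup>2 \<partial>\<mu>)"
    unfolding T_def cmod_g by (intro Bochner_Integration.integral_cong refl) (simp add: indicator_def)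
  have T0: "T \<ge> 0" by (simp add: T_def)
  have L0: "L \<ge> 0" by (simp add: L_def)
  have iE: "integrable \<mu> (indicator E :: real \<Rightarrow> real)"
    by (rule integrable_bounded[where B = 1]) (auto simp: indicator_def)
  have int_E: "Sigma_Algebra.measure \<mu> (E \<inter> {0..1}) = \<tau>"
    unfolding \<tau>_def using sets.sets_into_space[OF E] by (simp add: Int_absorb2)
  have LT: "L\<^sup>2 \<le> \<tau> * T"
  proof -
    \<comment> \<open>Cauchy--Schwarz on \<open>E\<close>, from the square \<open>(|S| - c)\<^sup>2\<close>; the optimal \<open>c\<close> is \<open>L / \<tau>\<close>.\<close>
    have quad: "0 \<le> T - 2 * c * L + c\<^sup>2 * \<tau>" for c
    proof -
      have "0 \<le> (\<integral>\<alpha>. (cmod (g \<alpha>))\<^sup>2 - 2 * c * cmod (g \<alpha>) + c\<^sup>2 * indicator E \<alpha> \<partial>\<mu>)"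
      proof (rule Bochner_Integration.integral_nonneg)
        fix \<alpha>
        have "(cmod (g \<alpha>))\<^sup>2 - 2 * c * cmod (g \<alpha>) + c\<^sup>2 * indicator E \<alpha> = indicator E \<alpha> * (cmod (S \<alpha>) - c)\<^sup>2"
          by (cases "\<alpha> \<in> E") (simp_all add: cmod_g power2_diff)
        then show "0 \<le> (cmod (g \<alpha>))\<^sup>2 - 2 * c * cmod (g \<alpha>) + c\<^sup>2 * indicator E \<alpha>" by simp
      qed
      also have "\<dots> = T - 2 * c * L + c\<^sup>2 * \<tau>" using iE by (simp add: T_def L_def int_E)
      finally show ?thesis .
    qed
    show ?thesis
    proof (cases "\<tau> = 0")
      case True
      have "L \<le> (\<integral>\<alpha>. C * indicator E \<alpha> \<partial>\<mu>)" unfolding L_def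
      proof (rule Bochner_Integration.integral_mono)
        show "integrable \<mu> (\<lambda>\<alpha>. cmod (g \<alpha>))" by (rule integrable_cmod)
        show "integrable \<mu> (\<lambda>\<alpha>. C * indicator E \<alpha>)" using iE by (rule integrable_mult_right)
        show "cmod (g \<alpha>) \<le> C * indicator E \<alpha>" for \<alpha> using SC[of \<alpha>] by (simp add: cmod_g indicator_def)
      qed
      also have "\<dots> = 0" using True by (simp add: int_E)
      finally show ?thesis using L0 True by simp
    next
      case False
      then have "\<tau> > 0" using \<tau> by simp
      then show ?thesis using quad[of "L / \<tau>"] by (simp add: field_simps power2_eq_square)
    qed
  qed
  have z1: "z > 1" unfolding z_def using N by simp
  have z4: "z ^ 4 = N" unfolding z_def using N by (simp flip: powr_realpow add: powr_powr)
  have m: "N \<le> 2 * real m" "real m \<le> N / 2 + 1" unfolding m_def using N by linarith+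
  have Z: "18 * real m * \<tau> \<le> real Z" "real Z \<le> 9 * (N * \<tau>) + 20" "Z \<ge> 1"
  proof -
    have nn: "0 \<le> 18 * real m * \<tau>" using \<tau> by simp
    then show "18 * real m * \<tau> \<le> real Z" "Z \<ge> 1" unfolding Z_def by linarith+
    have "real Z \<le> 18 * real m * \<tau> + 2" unfolding Z_def using nn by linarith
    also have "18 * real m * \<tau> \<le> 18 * (N / 2 + 1) * \<tau>" using m \<tau> by (intro mult_right_mono mult_left_mono) auto
    also have "\<dots> \<le> 9 * (N * \<tau>) + 18" using \<tau> by (simp add: algebra_simps)
    finally show "real Z \<le> 9 * (N * \<tau>) + 20" by simp
  qed
  define A where "A = 1 + 2 * ln (36 * (N * \<tau>) + 80)"
  have A: "4 + 8 * ln (4 * real Z) \<le> 4 * A"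
  proof -
    have "ln (4 * real Z) \<le> ln (36 * (N * \<tau>) + 80)" using Z by (intro ln_mono) auto
    then show ?thesis by (simp add: A_def)
  qed
  have "ln N / 4 = ln z" unfolding z_def using N by (simp add: ln_powr)
  also have "\<dots> \<le> (4 + 8 * ln (4 * real Z)) * G"
    unfolding G_def unfolding \<P>_def using z1 Z by (intro presieved_sum_ge) auto
  also have "\<dots> \<le> 4 * A * G" using A G_nonneg by (rule mult_right_mono)
  finally have G_ge: "ln N \<le> 16 * A * G" by simp
  have lnN: "ln N > 0" using N by simp
  have Gpos: "G > 0" using G_ge lnN G_nonneg by (cases "G = 0") auto
  have invG: "1 / G \<le> 16 * A / ln N" using G_ge Gpos lnN by (simp add: field_simps)
  define Q where "Q = {p \<in> primes_upto N. real p > z}"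
  have "G * (\<Sum>p\<in>Q. (cmod (\<gamma> (int p)))\<^sup>2) \<le> 2 * T + 36 * real m / real Z * L\<^sup>2"
    unfolding T_def L_def
  proof (rule dual_sieve_inequality)
    show "z \<ge> 1" using z1 by simp
    show "z ^ 4 \<le> 2 * real m" using z4 m by simp
    show "real Z > 0" using Z by simp
    show "real Z \<le> real l - 1" if "l \<in> \<P>" for l using that by (simp add: \<P>_def)
    show "Q \<subseteq> {1..2 * m}"
    proof
      fix p assume "p \<in> Q"
      then have "prime p" "real p \<le> N" by (auto simp: Q_def primes_upto_def)
      then have "1 \<le> p" "real p \<le> real (2 * m)" using m by (auto dest: prime_ge_1_nat)
      then show "p \<in> {1..2 * m}" by (simp only: of_nat_le_iff atLeastAtMost_iff)
    qed
    show "\<not> l dvd p" if "p \<in> Q" "l \<in> \<P>" for p l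
    proof
      assume "l dvd p"
      moreover have "prime l" "prime p" using that by (auto simp: Q_def \<P>_def primes_upto_def)
      ultimately have "l = p" by (rule primes_dvd_imp_eq[rotated 2])
      then show False using that by (auto simp: Q_def \<P>_def primes_upto_def)
    qed
  qed
  also have "36 * real m / real Z * L\<^sup>2 \<le> 36 * real m / real Z * (\<tau> * T)"
    using LT by (intro mult_left_mono) auto
  also have "\<dots> = (36 * real m * \<tau> / real Z) * T" by simp
  also have "\<dots> \<le> 2 * T" using Z T0 by (intro mult_right_mono) (auto simp: field_simps)
  finally have large: "G * (\<Sum>p\<in>Q. (cmod (\<gamma> (int p)))\<^sup>2) \<le> 4 * T" by simp
  then have "(\<Sum>p\<in>Q. (cmod (\<gamma> (int p)))\<^sup>2) \<le> 4 * T * (1 / G)" using Gpos by (simp add: field_simps)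
  also have "\<dots> \<le> 4 * T * (16 * A / ln N)" using invG T0 by (intro mult_left_mono) auto
  finally have sumQ: "(\<Sum>p\<in>Q. (cmod (\<gamma> (int p)))\<^sup>2) \<le> 64 * A / ln N * T" by (simp add: mult_ac)
  have sub: "primes_upto z \<subseteq> {1..nat \<lfloor>z\<rfloor>}"
  proof
    fix p assume "p \<in> primes_upto z"
    then show "p \<in> {1..nat \<lfloor>z\<rfloor>}" by (auto simp: primes_upto_def le_nat_floor dest: prime_ge_1_nat)
  qed
  have "card (primes_upto z) \<le> nat \<lfloor>z\<rfloor>" using card_mono[OF _ sub] by simp
  then have cardz: "real (card (primes_upto z)) \<le> z" using z1 by linarith
  have "(\<Sum>p\<in>primes_upto z. (cmod (\<gamma> (int p)))\<^sup>2) \<le> (\<Sum>p\<in>primes_upto z. \<tau> * T)"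
  proof (rule sum_mono)
    fix p
    have "(cmod (\<gamma> (int p)))\<^sup>2 \<le> L\<^sup>2" unfolding L_def by (intro power_mono norm_\<gamma>_le) simp
    then show "(cmod (\<gamma> (int p)))\<^sup>2 \<le> \<tau> * T" using LT by linarith
  qed
  also have "\<dots> \<le> z * (\<tau> * T)" using cardz \<tau> T0 by (simp add: mult_right_mono)
  finally have sumz: "(\<Sum>p\<in>primes_upto z. (cmod (\<gamma> (int p)))\<^sup>2) \<le> z * \<tau> * T" by simp
  define K where "K = 64 * A / ln N + z * \<tau>"
  have A0: "A \<ge> 0"
  proof -
    have "0 \<le> ln (36 * (N * \<tau>) + 80)" using N \<tau> by (intro ln_ge_zero) simp
    then show ?thesis by (simp add: A_def)
  qed
  have K0: "K \<ge> 0" unfolding K_def using A0 lnN z1 \<tau> by simp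
  have finQ: "finite Q" by (simp add: Q_def)
  have subQ: "primes_upto N \<subseteq> Q \<union> primes_upto z" and disj: "Q \<inter> primes_upto z = {}"
    by (auto simp: Q_def primes_upto_def)
  have "(\<Sum>p\<in>primes_upto N. (cmod (\<gamma> (int p)))\<^sup>2) \<le> (\<Sum>p\<in>Q \<union> primes_upto z. (cmod (\<gamma> (int p)))\<^sup>2)"
    using finQ subQ by (intro sum_mono2) auto
  also have "\<dots> = (\<Sum>p\<in>Q. (cmod (\<gamma> (int p)))\<^sup>2) + (\<Sum>p\<in>primes_upto z. (cmod (\<gamma> (int p)))\<^sup>2)"
    using finQ disj by (intro sum.union_disjoint) auto
  also have "\<dots> \<le> K * T" using sumQ sumz by (simp add: K_def distrib_right)
  finally have sum\<gamma>: "(\<Sum>p\<in>primes_upto N. (cmod (\<gamma> (int p)))\<^sup>2) \<le> K * T" .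
  have "complex_of_real T = (\<integral>\<alpha>. complex_of_real ((cmod (g \<alpha>))\<^sup>2) \<partial>\<mu>)"
    unfolding T_def by (rule integral_complex_of_real[symmetric])
  also have "\<dots> = (\<integral>\<alpha>. (\<Sum>p\<in>primes_upto N. u p * (e_circ (of_int (int p) * \<alpha>) * g \<alpha>)) \<partial>\<mu>)"
  proof (intro Bochner_Integration.integral_cong refl)
    fix \<alpha>
    have "complex_of_real ((cmod (g \<alpha>))\<^sup>2) = indicator E \<alpha> * complex_of_real ((cmod (S \<alpha>))\<^sup>2)"
      by (cases "\<alpha> \<in> E") (simp_all add: cmod_g)
    also have "\<dots> = S \<alpha> * g \<alpha>" unfolding complex_norm_square g_def by (simp only: mult_ac)
    also have "\<dots> = (\<Sum>p\<in>primes_upto N. u p * (e_circ (of_int (int p) * \<alpha>) * g \<alpha>))"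
      unfolding S_def sum_distrib_right by (simp add: mult.assoc)
    finally show "complex_of_real ((cmod (g \<alpha>))\<^sup>2) = (\<Sum>p\<in>primes_upto N. u p * (e_circ (of_int (int p) * \<alpha>) * g \<alpha>))" .
  qed
  also have "\<dots> = (\<Sum>p\<in>primes_upto N. \<integral>\<alpha>. u p * (e_circ (of_int (int p) * \<alpha>) * g \<alpha>) \<partial>\<mu>)"
    by (rule Bochner_Integration.integral_sum) (intro integrable_mult_right integrable_e_g)
  also have "\<dots> = (\<Sum>p\<in>primes_upto N. u p * \<gamma> (int p))"
    unfolding \<gamma>_def by (simp only: integral_mult_right_zero)
  finally have "T = cmod (\<Sum>p\<in>primes_upto N. u p * \<gamma> (int p))" using T0 by (metis abs_of_nonneg norm_of_real)
  also have "\<dots> \<le> (\<Sum>p\<in>primes_upto N. cmod (u p) * cmod (\<gamma> (int p)))"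
    by (rule order_trans[OF norm_sum]) (simp add: norm_mult)
  finally have "T\<^sup>2 \<le> (\<Sum>p\<in>primes_upto N. cmod (u p) * cmod (\<gamma> (int p)))\<^sup>2" using T0 by (intro power_mono)
  also have "\<dots> \<le> U * (\<Sum>p\<in>primes_upto N. (cmod (\<gamma> (int p)))\<^sup>2)" unfolding U_def by (rule Cauchy_Schwarz_ineq_sum)
  also have "\<dots> \<le> U * (K * T)" using sum\<gamma> by (intro mult_left_mono) (auto simp: U_def sum_nonneg)
  finally have "T * T \<le> (K * U) * T" by (simp add: power2_eq_square mult_ac)
  moreover have "0 \<le> K * U" using K0 by (simp add: U_def sum_nonneg)
  ultimately have "T \<le> K * U" using T0 by (cases "T = 0") auto
  then show ?thesis unfolding T_eq[symmetric] K_def A_def z_def U_def .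
qed

section \<open>Summation over level sets\<close>

text \<open>With \<open>y = x\<^bsup>1/3\<^esup>\<close> and \<open>ln x = 3 ln y \<le> 3 y\<close>, the hypothesis becomes \<open>y\<^sup>3 \<le> 4\<^bsup>k\<^esup> 2\<^bsup>13\<^esup> y\<close>.\<close>
lemma ln_bound_of_self_bound:
  fixes x :: real
  assumes x: "x \<ge> 1" and le: "x \<le> 4 ^ k * (2304 * ln x + 1268)"
  shows "ln x \<le> 13.65 + 2.1 * real k"
proof -
  define y where "y = x powr (1/3)"
  have y1: "y \<ge> 1" unfolding y_def using x by (simp add: ge_one_powr_ge_zero)
  have y3: "y ^ 3 = x" unfolding y_def using x by (simp flip: powr_realpow add: powr_powr)
  have lny: "ln x = 3 * ln y" unfolding y_def using x by (simp add: ln_powr)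
  have "ln y \<le> y" using y1 ln_le_minus_one[of y] by simp
  \<comment> \<open>8192 is the first power of 2 above \<open>3 * 2304 + 1268\<close>.\<close>
  then have "2304 * ln x + 1268 \<le> 8192 * y" using y1 lny by simp
  then have "x \<le> 4 ^ k * (8192 * y)" using le by (meson mult_left_mono order_trans zero_le_numeral zero_le_power)
  then have "y * y\<^sup>2 \<le> y * (4 ^ k * 8192)" using y3 by (simp add: power3_eq_cube power2_eq_square mult_ac)
  then have "y\<^sup>2 \<le> 4 ^ k * 8192" using y1 by (subst (asm) mult_le_cancel_left_pos) auto
  also have "\<dots> = 2 ^ (2 * k + 13)" by (simp add: power_add power_mult)
  finally have "ln (y\<^sup>2) \<le> ln (2 ^ (2 * k + 13))" using y1 by (intro ln_mono) auto
  also have "\<dots> = real (2 * k + 13) * ln 2" by (rule ln_realpow)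
  also have "\<dots> \<le> real (2 * k + 13) * (25/36)" by (intro mult_left_mono ln2_le_25_over_36) simp
  finally have "2 * ln y \<le> real (2 * k + 13) * (25/36)" using y1 by (simp add: ln_realpow)
  then show ?thesis using lny by simp
qed

text \<open>If \<open>f\<close> lies between \<open>b / 2\<^bsup>k+1\<^esup>\<close> and \<open>b / 2\<^bsup>k\<^esup>\<close> with \<open>k < J\<close>, the weights of the levels below \<open>f\<close> telescope to
  \<open>r\<^bsup>k\<^esup> - r\<^bsup>J\<^esup>\<close>.  The remainder \<open>r\<^bsup>J\<^esup>\<close> pays for the values of \<open>f\<close> below all levels.\<close>
lemma level_decomposition:
  fixes f b r h :: real
  assumes b: "b > 0" and f: "0 \<le> f" "f \<le> b" and h: "h > 0" and r: "r = 2 powr (- h)"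
  shows "(f / b) powr h \<le> (\<Sum>j<J. (r ^ j - r ^ Suc j) * of_bool (b / 2 ^ Suc j < f)) + r ^ J"
proof -
  have r01: "0 < r" "r < 1" using h by (simp_all add: r powr_less_one)
  have dec: "r ^ j - r ^ Suc j \<ge> 0" for j using r01 by (simp add: mult_left_le_one_le)
  show ?thesis
  proof (induction J)
    case 0
    have "(f / b) powr h \<le> 1 powr h" using assms by (intro powr_mono2) auto
    then show ?case by simp
  next
    case (Suc J)
    show ?case
    proof (cases "b / 2 ^ Suc J < f")
      case True
      then show ?thesis using Suc by simp
    next
      case False
      have "f / b \<le> (1/2) ^ Suc J" using False b by (simp add: field_simps)
      then have "(f / b) powr h \<le> ((1/2) ^ Suc J) powr h" using assms by (intro powr_mono2) auto
      also have "((1/2) ^ Suc J) powr h = r ^ Suc J"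
      proof -
        have "((1/2::real) ^ n) powr h = ((1/2) powr h) ^ n" for n
          by (induction n) (simp_all only: power_0 power_Suc powr_mult powr_one_eq_one)
        then have "((1/2::real) ^ Suc J) powr h = ((1/2) powr h) ^ Suc J" .
        also have "(1/2::real) powr h = r" unfolding r by (simp add: powr_minus powr_divide inverse_eq_divide)
        finally show ?thesis .
      qed
      finally have "(f / b) powr h \<le> r ^ Suc J" .
      moreover have "0 \<le> (\<Sum>j<Suc J. (r ^ j - r ^ Suc j) * of_bool (b / 2 ^ Suc j < f))"
        by (intro sum_nonneg mult_nonneg_nonneg dec) auto
      ultimately show ?thesis by linarith
    qed
  qed
qed

text \<open>Summation by parts turns the second sum into \<open>(\<Sum>j<J. r\<^bsup>j\<^esup>) - J r\<^bsup>J\<^esup>\<close>.  This is where \<open>1/h\<close> comes from.\<close>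
lemma telescoping_weights:
  fixes r :: real
  assumes "0 < r" "r < 1"
  shows "(\<Sum>j<J. (r ^ j - r ^ Suc j)) \<le> 1"
    and "(\<Sum>j<J. (r ^ j - r ^ Suc j) * (real j + 1)) \<le> 1 / (1 - r)"
proof -
  have "(\<Sum>j<J. (r ^ j - r ^ Suc j)) = 1 - r ^ J" by (induction J) auto
  then show "(\<Sum>j<J. (r ^ j - r ^ Suc j)) \<le> 1" using assms by simp
  have "(\<Sum>j<J. (r ^ j - r ^ Suc j) * (real j + 1)) = (\<Sum>j<J. r ^ j) - real J * r ^ J"
    by (induction J) (auto simp: algebra_simps)
  also have "\<dots> \<le> (\<Sum>j<J. r ^ j)" using assms by simp
  also have "\<dots> = (1 - r ^ J) / (1 - r)" using assms by (simp add: sum_gp_strict)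
  also have "\<dots> \<le> 1 / (1 - r)" using assms by (intro divide_right_mono) auto
  finally show "(\<Sum>j<J. (r ^ j - r ^ Suc j) * (real j + 1)) \<le> 1 / (1 - r)" .
qed

lemma inverse_one_minus_powr_le:
  assumes h: "h > (0::real)"
  shows "1 / (1 - 2 powr (- h)) \<le> 1 + 3 / (2 * h)"
proof -
  define w where "w = 2 powr h"
  have "1 + h * (2/3) \<le> 1 + h * ln 2" using h ln2_ge_two_thirds by simp
  also have "\<dots> \<le> exp (h * ln 2)" by (rule exp_ge_add_one_self)
  also have "\<dots> = w" by (simp add: w_def powr_def)
  finally have w: "w - 1 \<ge> 2 * h / 3" by simp
  have w1: "w > 1" using w h by linarith
  have "1 / (1 - 2 powr (- h)) = 1 + 1 / (w - 1)" using w1 by (simp add: powr_minus w_def[symmetric] field_simps)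
  also have "1 / (w - 1) \<le> 1 / (2 * h / 3)" using w h by (intro divide_left_mono) auto
  finally show ?thesis by simp
qed

lemma parseval_nat:
  fixes A :: "nat set"
  assumes "finite A"
  shows "(\<integral>\<alpha>. (cmod (\<Sum>p\<in>A. u p * e_circ (real p * \<alpha>)))\<^sup>2 \<partial>\<mu>) = (\<Sum>p\<in>A. (cmod (u p))\<^sup>2)"
proof -
  have "(\<Sum>n\<in>int ` A. f n) = (\<Sum>p\<in>A. f (int p))" for f :: "int \<Rightarrow> real"
    by (subst sum.reindex) auto
  moreover have "(\<Sum>n\<in>int ` A. f n) = (\<Sum>p\<in>A. f (int p))" for f :: "int \<Rightarrow> complex"
    by (subst sum.reindex) auto
  ultimately show ?thesis
    using parseval[of "int ` A" "\<lambda>n. u (nat n)"] assms by simp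
qed

text \<open>Cauchy--Schwarz and the Chebyshev bound for the number of primes up to \<open>N\<close>.\<close>
lemma exponential_sum_sup:
  assumes N: "N \<ge> 1000"
  shows "(cmod (\<Sum>p\<in>primes_upto N. u p * e_circ (real p * \<alpha>)))\<^sup>2 \<le>
    (2 * N / ln N * (\<Sum>p\<in>primes_upto N. (cmod (u p))\<^sup>2)) * (0.926 + 2.25 / ln N)"
proof -
  let ?U = "\<Sum>p\<in>primes_upto N. (cmod (u p))\<^sup>2"
  have "cmod (\<Sum>p\<in>primes_upto N. u p * e_circ (real p * \<alpha>)) \<le> (\<Sum>p\<in>primes_upto N. 1 * cmod (u p))"
    by (rule order_trans[OF norm_sum]) (simp add: norm_mult)
  then have "(cmod (\<Sum>p\<in>primes_upto N. u p * e_circ (real p * \<alpha>)))\<^sup>2 \<le> (\<Sum>p\<in>primes_upto N. 1 * cmod (u p))\<^sup>2"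
    by (intro power_mono) auto
  also have "\<dots> \<le> (\<Sum>p\<in>primes_upto N. 1\<^sup>2) * ?U" by (rule Cauchy_Schwarz_ineq_sum)
  also have "\<dots> = real (card (primes_upto N)) * ?U" by simp
  also have "\<dots> \<le> N / ln N * (1.852 + 4.5 / ln N) * ?U"
    by (intro mult_right_mono card_primes_upto_le N sum_nonneg) simp
  also have "\<dots> = (2 * N / ln N * ?U) * (0.926 + 2.25 / ln N)" by (simp add: algebra_simps)
  finally show ?thesis .
qed

text \<open>Let \<open>t\<close> be \<open>N\<close> times the measure of \<open>E k\<close> and \<open>x = 36 t + 80\<close>.  For \<open>t \<le> sqrt N\<close> the restriction estimate bounds
  the left-hand side by \<open>D (64 ln x + 33)\<close>, and for larger \<open>t\<close> so does Parseval.  As \<open>|S|\<^sup>2 > D / 4\<^bsup>k\<^esup>\<close> on \<open>E k\<close>,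
  this forces \<open>t \<le> 4\<^bsup>k\<^esup> (64 ln x + 33)\<close>, hence \<open>ln x = O(k + 1)\<close>, which is inserted again.\<close>
lemma large_values_estimate:
  fixes N :: real and u :: "nat \<Rightarrow> complex"
  defines "S \<equiv> \<lambda>\<alpha>. \<Sum>p\<in>primes_upto N. u p * e_circ (real p * \<alpha>)"
    and "D \<equiv> 2 * N / ln N * (\<Sum>p\<in>primes_upto N. (cmod (u p))\<^sup>2)"
  assumes N: "N \<ge> 1000" and U: "(\<Sum>p\<in>primes_upto N. (cmod (u p))\<^sup>2) > 0"
  defines "E \<equiv> \<lambda>k. {\<alpha> \<in> space \<mu>. sqrt D / 2 ^ k < cmod (S \<alpha>)}"
  shows "N * (\<integral>\<alpha>. indicator (E k) \<alpha> * (cmod (S \<alpha>))\<^sup>2 \<partial>\<mu>) \<le> D * (907 + 135 * real k)"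
proof -
  define U where "U = (\<Sum>p\<in>primes_upto N. (cmod (u p))\<^sup>2)"
  define \<tau> where "\<tau> = Sigma_Algebra.measure \<mu> (E k)"
  define T where "T = (\<integral>\<alpha>. indicator (E k) \<alpha> * (cmod (S \<alpha>))\<^sup>2 \<partial>\<mu>)"
  define t where "t = N * \<tau>"
  have lnN: "ln N > 0" using N by simp
  have D: "D > 0" "D * ln N = 2 * N * U" unfolding D_def using N U lnN by (simp_all add: U_def)
  have Sm [measurable]: "S \<in> borel_measurable \<mu>" unfolding S_def by measurable
  have Em [measurable]: "E k \<in> sets \<mu>" unfolding E_def by measurable
  have \<tau>0: "\<tau> \<ge> 0" by (simp add: \<tau>_def)
  have t0: "t \<ge> 0" using \<tau>0 N by (simp add: t_def)
  have Sb: "(cmod (S \<alpha>))\<^sup>2 \<le> D * (0.926 + 2.25 / ln N)" for \<alpha>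
    unfolding S_def D_def by (rule exponential_sum_sup[OF N])
  have iS: "integrable \<mu> (\<lambda>\<alpha>. (cmod (S \<alpha>))\<^sup>2)"
    by (rule integrable_bounded[where B = "D * (0.926 + 2.25 / ln N)"]) (use Sb in simp_all)
  have iE: "integrable \<mu> (\<lambda>\<alpha>. indicator (E k) \<alpha> * (cmod (S \<alpha>))\<^sup>2)"
    by (rule integrable_real_mult_indicator[OF Em iS, unfolded mult.commute[of _ "indicator _ _"]])
  have TU: "T \<le> U"
  proof -
    have "T \<le> (\<integral>\<alpha>. (cmod (S \<alpha>))\<^sup>2 \<partial>\<mu>)" unfolding T_def
      by (rule Bochner_Integration.integral_mono[OF iE iS]) (simp add: indicator_def)
    also have "\<dots> = U" unfolding S_def U_def by (rule parseval_nat) simp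
    finally show ?thesis .
  qed
  have cheb: "D / 4 ^ k * \<tau> \<le> T"
  proof -
    have Esub: "E k \<inter> {0..1} = E k" by (auto simp: E_def)
    have "D / 4 ^ k * \<tau> = (\<integral>\<alpha>. D / 4 ^ k * indicator (E k) \<alpha> \<partial>\<mu>)" by (simp add: \<tau>_def Esub)
    also have "\<dots> \<le> T" unfolding T_def
    proof (rule Bochner_Integration.integral_mono[OF _ iE])
      show "integrable \<mu> (\<lambda>\<alpha>. D / 4 ^ k * indicator (E k) \<alpha>)"
        by (rule integrable_bounded[where B = "\<bar>D / 4 ^ k\<bar>"]) (auto simp: indicator_def)
      fix \<alpha>
      show "D / 4 ^ k * indicator (E k) \<alpha> \<le> indicator (E k) \<alpha> * (cmod (S \<alpha>))\<^sup>2"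
      proof (cases "\<alpha> \<in> E k")
        case True
        then have "(sqrt D / 2 ^ k)\<^sup>2 \<le> (cmod (S \<alpha>))\<^sup>2" using D by (intro power_mono) (auto simp: E_def)
        moreover have "(sqrt D / 2 ^ k)\<^sup>2 = D / 4 ^ k"
          using D by (simp add: power_divide power2_eq_square flip: power_mult_distrib)
        ultimately show ?thesis using True by simp
      qed simp
    qed
    finally show ?thesis .
  qed
  define x where "x = 36 * t + 80"
  have x: "x \<ge> 80" using t0 by (simp add: x_def)
  have lnx: "ln x \<ge> 0" using x by simp
  have NT: "N * T \<le> D * (64 * ln x + 33)"
  proof (cases "t \<le> N powr (1/2)")
    case True
    have "T \<le> (64 * (1 + 2 * ln x) / ln N + N powr (1/4) * \<tau>) * U"
      unfolding T_def U_def x_def t_def \<tau>_def S_def using N Em by (intro restriction_estimate) auto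
    then have "N * T \<le> N * ((64 * (1 + 2 * ln x) / ln N + N powr (1/4) * \<tau>) * U)" using N by (intro mult_left_mono) auto
    also have "\<dots> = (64 * (1 + 2 * ln x) / ln N + N powr (1/4) * \<tau>) * (N * U)" by (simp only: mult_ac)
    also have "N * U = D * ln N / 2" using D by simp
    also have "(64 * (1 + 2 * ln x) / ln N + N powr (1/4) * \<tau>) * (D * ln N / 2) =
       D * (32 * (1 + 2 * ln x) + N powr (1/4) * \<tau> * ln N / 2)" using lnN by (simp add: field_simps)
    \<comment> \<open>The contribution of the primes up to \<open>N\<^bsup>1/4\<^esup>\<close> is negligible in this range of \<open>t\<close>.\<close>
    also have "N powr (1/4) * \<tau> * ln N / 2 \<le> 1"
    proof -
      have l1: "ln N \<ge> 6"
      proof -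
        have "exp (6::real) = exp 1 ^ 6" by (simp flip: exp_of_nat_mult)
        also have "\<dots> \<le> 3 ^ 6" by (intro power_mono exp_le) auto
        also have "\<dots> \<le> N" using N by simp
        finally show ?thesis using N by (subst ln_ge_iff) auto
      qed
      have "N powr (1/4) * \<tau> * N = N powr (1/4) * t" by (simp add: t_def)
      also have "\<dots> \<le> N powr (1/4) * N powr (1/2)" using True by (intro mult_left_mono) auto
      also have "\<dots> = N powr (3/4)" by (simp flip: powr_add)
      finally have a: "N powr (1/4) * \<tau> * N \<le> N powr (3/4)" .
      have "6 * ln N \<le> (ln N)\<^sup>2" using l1 by (simp add: power2_eq_square)
      also have "\<dots> \<le> 8.8 * N powr (1/4)" using N by (intro ln_power2_le) simp
      finally have b: "ln N / 2 \<le> N powr (1/4)" using powr_ge_zero[of N "1/4"] by linarith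
      have "(N powr (1/4) * \<tau> * N) * (ln N / 2) \<le> N powr (3/4) * N powr (1/4)"
        using a b lnN by (intro mult_mono) auto
      also have "\<dots> = N" using N by (simp flip: powr_add)
      finally show ?thesis using N by (simp add: field_simps)
    qed
    then have "D * (32 * (1 + 2 * ln x) + N powr (1/4) * \<tau> * ln N / 2) \<le> D * (32 * (1 + 2 * ln x) + 1)"
      using D by (intro mult_left_mono) auto
    finally show ?thesis by (simp add: algebra_simps)
  next
    case False
    have "ln N = 2 * ln (N powr (1/2))" using N by (simp add: ln_powr)
    also have "\<dots> \<le> 2 * ln x" using False t0 N unfolding x_def by (intro mult_left_mono ln_mono) auto
    finally have "ln N \<le> 2 * ln x" .
    have "N * T \<le> N * U" using TU N by simp
    also have "\<dots> = D * (ln N / 2)" using D by simp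
    also have "\<dots> \<le> D * (64 * ln x + 33)" using D \<open>ln N \<le> 2 * ln x\<close> lnx by (intro mult_left_mono) auto
    finally show ?thesis .
  qed
  have "D * t / 4 ^ k = N * (D / 4 ^ k * \<tau>)" by (simp add: t_def)
  also have "\<dots> \<le> N * T" using cheb N by (intro mult_left_mono) auto
  also note NT
  finally have "D * (t / 4 ^ k) \<le> D * (64 * ln x + 33)" by simp
  then have "t / 4 ^ k \<le> 64 * ln x + 33" using D by (simp only: mult_le_cancel_left_pos)
  then have t_le: "t \<le> 4 ^ k * (64 * ln x + 33)" by (simp add: field_simps)
  \<comment> \<open>1268 is \<open>36 * 33 + 80\<close>.\<close>
  have "80 \<le> 4 ^ k * (80::real)" by simp
  then have "36 * t + 80 \<le> 36 * (4 ^ k * (64 * ln x + 33)) + 4 ^ k * 80" using t_le by linarith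
  then have "x \<le> 4 ^ k * (2304 * ln x + 1268)" by (simp add: x_def algebra_simps)
  then have "ln x \<le> 13.65 + 2.1 * real k" using x by (intro ln_bound_of_self_bound) auto
  then have "64 * ln x + 33 \<le> 907 + 135 * real k" by simp
  then have "D * (64 * ln x + 33) \<le> D * (907 + 135 * real k)" using D by (intro mult_left_mono) auto
  with NT show ?thesis unfolding T_def by linarith
qed

theorem corollary1p3:
  fixes N h :: real and u :: "nat \<Rightarrow> complex"
  assumes "N \<ge> 1000" and "h > 0"
  shows "integral {0..1} (\<lambda>\<alpha>::real. cmod (\<Sum>p\<in>primes_upto N. u p * e_circ (real p * \<alpha>)) powr (2 + h))
    \<le> 7000 * (((1 + 3 / (2 * ln N)) powr h + 1 / h) / N)
        * ((2 * N / ln N) * (\<Sum>p\<in>primes_upto N. (cmod (u p))\<^sup>2)) powr (1 + h / 2)"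
proof -
  define S where "S = (\<lambda>\<alpha>. \<Sum>p\<in>primes_upto N. u p * e_circ (real p * \<alpha>))"
  define U where "U = (\<Sum>p\<in>primes_upto N. (cmod (u p))\<^sup>2)"
  define D where "D = 2 * N / ln N * U"
  define b where "b = sqrt D"
  define C where "C = 1 + 3 / (2 * ln N)"
  have N: "N \<ge> 1000" and h: "h > 0" using assms by auto
  have lnN: "ln N > 0" using N by simp
  have U0: "U \<ge> 0" by (simp add: U_def sum_nonneg)
  have C1: "C \<ge> 1" using lnN by (simp add: C_def)
  have Sm [measurable]: "S \<in> borel_measurable \<mu>" unfolding S_def by measurable
  have Sb: "(cmod (S \<alpha>))\<^sup>2 \<le> D * (0.926 + 2.25 / ln N)" for \<alpha>
    unfolding S_def D_def U_def by (rule exponential_sum_sup[OF N])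
  have D0: "D \<ge> 0" unfolding D_def using N lnN U0 by simp
  have b0: "b \<ge> 0" "b\<^sup>2 = D" using D0 by (simp_all add: b_def)
  have sup: "cmod (S \<alpha>) \<le> b * C" for \<alpha>
  proof -
    have "0.926 + 2.25 / ln N \<le> C\<^sup>2" using lnN by (simp add: C_def power2_eq_square field_simps)
    then have "D * (0.926 + 2.25 / ln N) \<le> D * C\<^sup>2" using D0 by (rule mult_left_mono)
    then have "(cmod (S \<alpha>))\<^sup>2 \<le> (b * C)\<^sup>2" using Sb[of \<alpha>] b0 by (simp add: power_mult_distrib)
    then show ?thesis by (rule power2_le_imp_le) (use b0 C1 in simp)
  qed
  have powr_split: "x powr (2 + h) = x powr h * x\<^sup>2" if "x \<ge> 0" for x :: real
  proof (cases "x = 0")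
    case False
    then have "x powr 2 = x\<^sup>2" using that by simp
    then show ?thesis by (simp only: powr_add mult.commute)
  qed simp
  have iS: "integrable \<mu> (\<lambda>\<alpha>. (cmod (S \<alpha>))\<^sup>2)"
    by (rule integrable_bounded[where B = "D * (0.926 + 2.25 / ln N)"]) (use Sb in simp_all)
  have iSh: "integrable \<mu> (\<lambda>\<alpha>. cmod (S \<alpha>) powr (2 + h))"
  proof (rule integrable_bounded)
    show "norm (cmod (S \<alpha>) powr (2 + h)) \<le> (b * C) powr (2 + h)" for \<alpha>
      using sup[of \<alpha>] h by (simp add: powr_mono2)
  qed measurable
  have int_eq: "integral {0..1} (\<lambda>\<alpha>. cmod (S \<alpha>) powr (2 + h)) = (\<integral>\<alpha>. cmod (S \<alpha>) powr (2 + h) \<partial>\<mu>)"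
    by (rule lebesgue_integral_eq_integral[symmetric]) (use iSh in auto)
  have pars: "(\<integral>\<alpha>. (cmod (S \<alpha>))\<^sup>2 \<partial>\<mu>) = U" unfolding S_def U_def by (rule parseval_nat) simp
  have rhs: "D powr (1 + h / 2) = b powr h * D"
  proof -
    have "D powr (1 + h / 2) = b powr (2 + h)"
      unfolding b_def by (simp add: powr_half_sqrt[OF D0, symmetric] powr_powr add_divide_distrib)
    then show ?thesis using powr_split[OF b0(1)] b0 by simp
  qed
  have NU: "N * U = D * (ln N / 2)" unfolding D_def using lnN by simp
  have main: "N * (\<integral>\<alpha>. cmod (S \<alpha>) powr (2 + h) \<partial>\<mu>) \<le> 7000 * (C powr h + 1 / h) * (b powr h * D)"
  proof (cases "ln N \<le> 14000 \<or> U = 0")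
    case True
    have "(\<integral>\<alpha>. cmod (S \<alpha>) powr (2 + h) \<partial>\<mu>) \<le> (\<integral>\<alpha>. (b * C) powr h * (cmod (S \<alpha>))\<^sup>2 \<partial>\<mu>)"
    proof (rule Bochner_Integration.integral_mono[OF iSh])
      show "integrable \<mu> (\<lambda>\<alpha>. (b * C) powr h * (cmod (S \<alpha>))\<^sup>2)" using iS by simp
      show "cmod (S \<alpha>) powr (2 + h) \<le> (b * C) powr h * (cmod (S \<alpha>))\<^sup>2" for \<alpha>
        unfolding powr_split[OF norm_ge_zero] using sup[of \<alpha>] h by (intro mult_right_mono powr_mono2) auto
    qed
    also have "\<dots> = b powr h * C powr h * U" using b0 C1 by (simp add: pars powr_mult)
    finally have "N * (\<integral>\<alpha>. cmod (S \<alpha>) powr (2 + h) \<partial>\<mu>) \<le> N * (b powr h * C powr h * U)"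
      using N by (intro mult_left_mono) auto
    also have "\<dots> = b powr h * C powr h * (N * U)" by (simp only: mult_ac)
    also have "N * U \<le> D * 7000"
    proof (cases "U = 0")
      case False
      then show ?thesis unfolding NU using True D0 by (intro mult_left_mono) auto
    qed (simp add: D0)
    then have "b powr h * C powr h * (N * U) \<le> b powr h * C powr h * (D * 7000)" by (intro mult_left_mono) auto
    also have "\<dots> = 7000 * C powr h * (b powr h * D)" by (simp only: mult_ac)
    also have "\<dots> \<le> 7000 * (C powr h + 1 / h) * (b powr h * D)"
      using h D0 by (intro mult_right_mono mult_left_mono) auto
    finally show ?thesis .
  next
    case False
    then have big: "ln N > 14000" and Upos: "U > 0" using U0 by auto
    have Dpos: "D > 0" unfolding D_def using N lnN Upos by simp
    have bpos: "b > 0" using Dpos by (simp add: b_def)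
    have Sle: "cmod (S \<alpha>) \<le> b" for \<alpha>
    proof -
      have "0.926 + 2.25 / ln N \<le> 1" using big by (simp add: field_simps)
      then have "D * (0.926 + 2.25 / ln N) \<le> D * 1" using D0 by (rule mult_left_mono)
      then have "(cmod (S \<alpha>))\<^sup>2 \<le> b\<^sup>2" using Sb[of \<alpha>] b0 by simp
      then show ?thesis by (rule power2_le_imp_le) (use b0 in simp)
    qed
    define r where "r = 2 powr (- h)"
    have r01: "0 < r" "r < 1" using h by (simp_all add: r_def powr_less_one)
    \<comment> \<open>So many levels that the values of \<open>|S|\<close> below all of them contribute at most 1.\<close>
    obtain J where "r ^ J < 2 / ln N" using real_arch_pow_inv[of "2 / ln N" r] r01 lnN by auto
    then have J: "r ^ J * (ln N / 2) \<le> 1" using lnN by (simp add: field_simps)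
    define E where "E k = {\<alpha> \<in> space \<mu>. b / 2 ^ k < cmod (S \<alpha>)}" for k
    have Em [measurable]: "E k \<in> sets \<mu>" for k unfolding E_def by measurable
    let ?I = "\<lambda>k. \<integral>\<alpha>. indicator (E k) \<alpha> * (cmod (S \<alpha>))\<^sup>2 \<partial>\<mu>"
    have I_le: "N * ?I k \<le> D * (907 + 135 * real k)" for k
      using large_values_estimate[OF N Upos[unfolded U_def], of k] unfolding E_def S_def b_def D_def U_def .
    have iE: "integrable \<mu> (\<lambda>\<alpha>. indicator (E k) \<alpha> * (cmod (S \<alpha>))\<^sup>2)" for k
      by (rule integrable_real_mult_indicator[OF Em iS, unfolded mult.commute[of _ "indicator _ _"]])
    define d where "d j = r ^ j - r ^ Suc j" for j
    have d0: "d j \<ge> 0" for j using r01 by (simp add: d_def mult_left_le_one_le)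
    let ?R = "\<lambda>\<alpha>. b powr h * ((\<Sum>j<J. d j * (indicator (E (Suc j)) \<alpha> * (cmod (S \<alpha>))\<^sup>2)) + r ^ J * (cmod (S \<alpha>))\<^sup>2)"
    have "(\<integral>\<alpha>. cmod (S \<alpha>) powr (2 + h) \<partial>\<mu>) \<le> (\<integral>\<alpha>. ?R \<alpha> \<partial>\<mu>)"
    proof (rule Bochner_Integration.integral_mono[OF iSh])
      show "integrable \<mu> ?R"
        by (intro integrable_mult_right Bochner_Integration.integrable_add Bochner_Integration.integrable_sum iE iS)
      fix \<alpha> assume \<alpha>: "\<alpha> \<in> space \<mu>"
      have ind: "of_bool (b / 2 ^ Suc j < cmod (S \<alpha>)) = (indicator (E (Suc j)) \<alpha> :: real)" for j
        using \<alpha> by (simp add: E_def indicator_def)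
      have "(cmod (S \<alpha>) / b) powr h \<le> (\<Sum>j<J. d j * indicator (E (Suc j)) \<alpha>) + r ^ J"
        using level_decomposition[OF bpos norm_ge_zero Sle h r_def, of \<alpha> J] unfolding ind d_def .
      then have "(cmod (S \<alpha>) / b) powr h * (b powr h * (cmod (S \<alpha>))\<^sup>2) \<le>
          ((\<Sum>j<J. d j * indicator (E (Suc j)) \<alpha>) + r ^ J) * (b powr h * (cmod (S \<alpha>))\<^sup>2)"
        by (rule mult_right_mono) simp
      also have "(cmod (S \<alpha>) / b) powr h * (b powr h * (cmod (S \<alpha>))\<^sup>2) = cmod (S \<alpha>) powr (2 + h)"
        unfolding powr_split[OF norm_ge_zero] using bpos by (simp add: powr_divide)
      also have "((\<Sum>j<J. d j * indicator (E (Suc j)) \<alpha>) + r ^ J) * (b powr h * (cmod (S \<alpha>))\<^sup>2) = ?R \<alpha>"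
        by (simp only: sum_distrib_left sum_distrib_right distrib_left distrib_right mult_ac)
      finally show "cmod (S \<alpha>) powr (2 + h) \<le> ?R \<alpha>" .
    qed
    also have "(\<integral>\<alpha>. ?R \<alpha> \<partial>\<mu>) = b powr h * ((\<Sum>j<J. d j * ?I (Suc j)) + r ^ J * U)"
      using iE iS by (simp add: pars)
    finally have "N * (\<integral>\<alpha>. cmod (S \<alpha>) powr (2 + h) \<partial>\<mu>) \<le> N * (b powr h * ((\<Sum>j<J. d j * ?I (Suc j)) + r ^ J * U))"
      using N by (intro mult_left_mono) auto
    also have "\<dots> = b powr h * ((\<Sum>j<J. d j * (N * ?I (Suc j))) + r ^ J * (N * U))"
      by (simp add: sum_distrib_left algebra_simps)
    also have "\<dots> \<le> b powr h * ((\<Sum>j<J. d j * (D * (907 + 135 * real (Suc j)))) + r ^ J * (N * U))"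
      by (intro mult_left_mono add_right_mono sum_mono I_le d0) simp
    also have "(\<Sum>j<J. d j * (D * (907 + 135 * real (Suc j)))) + r ^ J * (N * U) =
        D * (907 * (\<Sum>j<J. d j) + 135 * (\<Sum>j<J. d j * (real j + 1)) + r ^ J * (ln N / 2))"
    proof -
      have "d j * (D * (907 + 135 * real (Suc j))) = 907 * D * d j + 135 * D * (d j * (real j + 1))" for j
        by (simp add: algebra_simps)
      then have "(\<Sum>j<J. d j * (D * (907 + 135 * real (Suc j)))) =
          907 * D * (\<Sum>j<J. d j) + 135 * D * (\<Sum>j<J. d j * (real j + 1))"
        by (simp only: sum.distrib sum_distrib_left[symmetric])
      then show ?thesis unfolding NU by (simp only: distrib_left mult_ac)
    qed
    also have "b powr h * \<dots> \<le> b powr h * (D * (907 * 1 + 135 * (1 + 3 / (2 * h)) + 1))"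
    proof (intro mult_left_mono add_mono)
      show "(\<Sum>j<J. d j) \<le> 1" unfolding d_def by (rule telescoping_weights[OF r01])
      have "(\<Sum>j<J. d j * (real j + 1)) \<le> 1 / (1 - r)" unfolding d_def by (rule telescoping_weights[OF r01])
      also have "\<dots> \<le> 1 + 3 / (2 * h)" unfolding r_def by (rule inverse_one_minus_powr_le[OF h])
      finally show "(\<Sum>j<J. d j * (real j + 1)) \<le> 1 + 3 / (2 * h)" .
    qed (use J D0 in auto)
    also have "\<dots> \<le> b powr h * (D * (7000 * (1 + 1 / h)))"
      using h D0 by (intro mult_left_mono) (auto simp: field_simps)
    also have "\<dots> \<le> b powr h * (D * (7000 * (C powr h + 1 / h)))"
      using h D0 C1 by (intro mult_left_mono add_right_mono) (auto simp: ge_one_powr_ge_zero)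
    finally show ?thesis by (simp only: mult_ac)
  qed
  have "integral {0..1} (\<lambda>\<alpha>. cmod (S \<alpha>) powr (2 + h)) \<le> 7000 * ((C powr h + 1 / h) / N) * D powr (1 + h / 2)"
    unfolding int_eq rhs using main N by (simp add: field_simps)
  then show ?thesis unfolding S_def C_def D_def U_def .
qed

end
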